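(* Let $X$ be a Banach space with a normalized $1$-unconditional basis $(e_n)_n$, let $(Y_n)_n$ be a sequence of Banach spaces, and $Z=(\sum Y_n)_X$. Assume that there are common $\lambda\ge1$ and $C\ge1$ so that each $Y_n$ has a $C$-strategically reproducible normalized Schauder basis $(e_i^{(n)})_i$ whose basis constant is at most $\lambda$. Let $(\tilde e_m)_{m\in\mathbb N}$ be an enumeration of $((e_i^{(n)})_i)_n$ such that for every $n$ and all $i<j$ the vector $e_i^{(n)}$ appears before $e_j^{(n)}$. Then $(\tilde e_m)_m$ is a $C$-strategically reproducible Schauder basis of $Z$ whose basis constant is at most $\lambda$.
   Context: All Banach spaces are real. $Z=(\sum Y_n)_X$ is the Banach space of all sequences $z=(y_n)_n$ with $y_n\in Y_n$ for which $\|z\|=\big\|\sum_{n}\|y_n\|_{Y_n}e_n\big\|_X$ is well defined (the series converges in $X$). Each $Y_k$ is identified isometrically with the subspace of $Z$ of sequences all of whose coordinates except possibly the $k$-th vanish. Impartial equivalence: sequences $(x_i)$, $(y_i)$ in Banach spaces are impartially $C$-equivalent if $\frac1{\sqrt C}\|\sum a_iy_i\|\le\|\sum a_ix_i\|\le\sqrt C\|\sum a_iy_i\|$ for all finitely supported real sequences $(a_i)$. Strategical reproducibility. Let $X$ be a Banach space with a normalized Schauder basis $(e_i)_{i\in\mathbb N}$ and biorthogonal functionals $(e_i^* )\subset X^*$. $\mathrm{cof}(X)$ is the set of closed finite-codimensional subspaces of $X$; $\mathrm{cof}_{w^*}(X^* )$ is the set of $w^*$-closed finite-codimensional subspaces of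 $X^*$. For $C\ge1$, $\eta>0$ the two-player game $\mathrm{Rep}_{(X,(e_i))}(C,\eta)$ is as follows. Before the first turn player (I) chooses a partition $\mathbb N=N_1\cup N_2$. For $k\in\mathbb N$, turn $k$ has three steps. Step 1: player (I) chooses $\eta_k>0$, $W_k\in\mathrm{cof}(X)$, $G_k\in\mathrm{cof}_{w^*}(X^* )$. Step 2: player (II) chooses $i_k\in\{1,2\}$, a finite set $E_k\subset N_{i_k}$ and non-negative reals $(\lambda_i^{(k)})_{i\in E_k}$, $(\mu_i^{(k)})_{i\in E_k}$ with $1-\eta<\sum_{i\in E_k}\lambda_i^{(k)}\mu_i^{(k)}<1+\eta$. Step 3: player (I) chooses signs $(\varepsilon_i^{(k)})_{i\in E_k}\in\{-1,1\}^{E_k}$. Put $x_k=\sum_{i\in E_k}\varepsilon_i^{(k)}\lambda_i^{(k)}e_i$ and $x_k^*=\sum_{i\in E_k}\varepsilon_i^{(k)}\mu_i^{(k)}e_i^*$. Player (II) wins if: (i) $(x_k)_k$ and $(e_k)_k$ are impartially $(C+\eta)$-equivalent; (ii) $(x_k^* )_k$ and $(e_k^* )_k$ are impartially $(C+\eta)$-equivalent; (iii) $\mathrm{dist}(x_k,W_k)<\eta_k$ for all $k$; (iv) $\mathrm{dist}(x_k^*,G_k)<\eta_k$ for all $k$. The basis $(e_i)_i$ is $C$-strategically reproducible in $X$ if for every $\eta>0$ player (II) has a winning strategy in $\mathrm{Rep}_{(X,(e_i))}(C,\eta)$. *)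

theory Defs
  imports "HOL-Analysis.Analysis" "HOL-Library.Function_Algebras"
begin

text \<open>
  Banach spaces occur here as a linear subspace \<open>V\<close> of an ambient real vector space together with
  a norm function \<open>nrm\<close> that is only meaningful on \<open>V\<close>; the ambient type carries no norm or
  topology. Every sequence of Banach spaces is of this form over a single type (their algebraic
  direct sum), and so are \<open>X\<close>-direct sums and dual spaces, whose elements are functions.
\<close>

instantiation "fun" :: (type, real_vector) real_vector
begin

definition scaleR_fun :: "real \<Rightarrow> ('a \<Rightarrow> 'b) \<Rightarrow> 'a \<Rightarrow> 'b"
  where "scaleR_fun r f = (\<lambda>x. r *\<^sub>R f x)"

instance
  by standard (simp_all add: scaleR_fun_def fun_eq_iff scaleR_add_left scaleR_add_right)

end

section \<open>Banach spaces, subspaces and duals\<close>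

definition norm_on :: "'a::real_vector set \<Rightarrow> ('a \<Rightarrow> real) \<Rightarrow> bool"
  where "norm_on V nrm \<longleftrightarrow>
    (\<forall>x\<in>V. 0 \<le> nrm x \<and> (nrm x = 0 \<longleftrightarrow> x = 0)) \<and>
    (\<forall>c. \<forall>x\<in>V. nrm (c *\<^sub>R x) = \<bar>c\<bar> * nrm x) \<and>
    (\<forall>x\<in>V. \<forall>y\<in>V. nrm (x + y) \<le> nrm x + nrm y)"

text \<open>The case distinction is needed because the locale \<^locale>\<open>Metric_space\<close> demands nonnegativity
  and symmetry of the distance also outside the carrier.\<close>

definition norm_dist :: "'a::real_vector set \<Rightarrow> ('a \<Rightarrow> real) \<Rightarrow> 'a \<Rightarrow> 'a \<Rightarrow> real"
  where "norm_dist V nrm x y = (if x \<in> V \<and> y \<in> V then nrm (x - y) else 0)"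

definition banach_on :: "'a::real_vector set \<Rightarrow> ('a \<Rightarrow> real) \<Rightarrow> bool"
  where "banach_on V nrm \<longleftrightarrow>
    subspace V \<and> norm_on V nrm \<and> Metric_space.mcomplete V (norm_dist V nrm)"

definition finite_codim :: "'a::real_vector set \<Rightarrow> 'a set \<Rightarrow> bool"
  where "finite_codim V W \<longleftrightarrow>
    subspace W \<and> W \<subseteq> V \<and> (\<exists>F. finite F \<and> F \<subseteq> V \<and> V = span (W \<union> F))"

definition cof :: "'a::real_vector set \<Rightarrow> ('a \<Rightarrow> real) \<Rightarrow> 'a set set"
  where "cof V nrm =
    {W. finite_codim V W \<and> closedin (Metric_space.mtopology V (norm_dist V nrm)) W}"

text \<open>Functionals on \<open>V\<close> are represented by their extension by zero to the ambient type, so that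
  distinct elements of the dual are distinct functions.\<close>

definition dual :: "'a::real_vector set \<Rightarrow> ('a \<Rightarrow> real) \<Rightarrow> ('a \<Rightarrow> real) set"
  where "dual V nrm = {f.
    (\<forall>x\<in>V. \<forall>y\<in>V. f (x + y) = f x + f y) \<and>
    (\<forall>c. \<forall>x\<in>V. f (c *\<^sub>R x) = c * f x) \<and>
    (\<exists>B. \<forall>x\<in>V. \<bar>f x\<bar> \<le> B * nrm x) \<and>
    (\<forall>x. x \<notin> V \<longrightarrow> f x = 0)}"

definition dual_norm :: "'a::real_vector set \<Rightarrow> ('a \<Rightarrow> real) \<Rightarrow> ('a \<Rightarrow> real) \<Rightarrow> real"
  where "dual_norm V nrm f = (SUP x\<in>{x\<in>V. nrm x \<le> 1}. \<bar>f x\<bar>)"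

text \<open>The topology of the function type is the product topology, that is, pointwise convergence.
  Elements of the dual vanish off \<open>V\<close>, so the topology it induces on the dual is pointwise
  convergence on \<open>V\<close>: the weak-* topology.\<close>

definition cof_wstar :: "'a::real_vector set \<Rightarrow> ('a \<Rightarrow> real) \<Rightarrow> ('a \<Rightarrow> real) set set"
  where "cof_wstar V nrm =
    {G. finite_codim (dual V nrm) G \<and> closedin (top_of_set (dual V nrm)) G}"

definition dist_set :: "('a::real_vector \<Rightarrow> real) \<Rightarrow> 'a \<Rightarrow> 'a set \<Rightarrow> real"
  where "dist_set nrm x W = (INF w\<in>W. nrm (x - w))"

section \<open>Schauder bases\<close>

definition basis_expansion ::
    "('a::real_vector \<Rightarrow> real) \<Rightarrow> (nat \<Rightarrow> 'a) \<Rightarrow> 'a \<Rightarrow> (nat \<Rightarrow> real) \<Rightarrow> bool"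
  where "basis_expansion nrm e x a \<longleftrightarrow> (\<lambda>n. nrm (x - (\<Sum>i<n. a i *\<^sub>R e i))) \<longlonglongrightarrow> 0"

definition schauder_basis :: "'a::real_vector set \<Rightarrow> ('a \<Rightarrow> real) \<Rightarrow> (nat \<Rightarrow> 'a) \<Rightarrow> bool"
  where "schauder_basis V nrm e \<longleftrightarrow>
    (\<forall>i. e i \<in> V) \<and> (\<forall>x\<in>V. \<exists>!a. basis_expansion nrm e x a)"

definition normalized :: "('a \<Rightarrow> real) \<Rightarrow> (nat \<Rightarrow> 'a) \<Rightarrow> bool"
  where "normalized nrm e \<longleftrightarrow> (\<forall>i. nrm (e i) = 1)"

definition biorth ::
    "'a::real_vector set \<Rightarrow> ('a \<Rightarrow> real) \<Rightarrow> (nat \<Rightarrow> 'a) \<Rightarrow> nat \<Rightarrow> 'a \<Rightarrow> real"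
  where "biorth V nrm e i x = (if x \<in> V then (THE a. basis_expansion nrm e x a) i else 0)"

text \<open>The supremum of the norms of the basis projections, extended-real-valued so that an
  upper bound on it is never vacuous.\<close>

definition basis_constant :: "'a::real_vector set \<Rightarrow> ('a \<Rightarrow> real) \<Rightarrow> (nat \<Rightarrow> 'a) \<Rightarrow> ereal"
  where "basis_constant V nrm e =
    (SUP n. SUP x\<in>{x\<in>V. nrm x \<le> 1}. ereal (nrm (\<Sum>i<n. biorth V nrm e i x *\<^sub>R e i)))"

definition unconditional :: "real \<Rightarrow> ('a::real_vector \<Rightarrow> real) \<Rightarrow> (nat \<Rightarrow> 'a) \<Rightarrow> bool"
  where "unconditional K nrm e \<longleftrightarrow>
    (\<forall>a \<epsilon> n. (\<forall>i. \<epsilon> i \<in> {-1, 1}) \<longrightarrow>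
      nrm (\<Sum>i<n. (\<epsilon> i * a i) *\<^sub>R e i) \<le> K * nrm (\<Sum>i<n. a i *\<^sub>R e i))"

definition impartially_equivalent ::
    "real \<Rightarrow> ('a::real_vector \<Rightarrow> real) \<Rightarrow> (nat \<Rightarrow> 'a)
      \<Rightarrow> ('b::real_vector \<Rightarrow> real) \<Rightarrow> (nat \<Rightarrow> 'b) \<Rightarrow> bool"
  where "impartially_equivalent C nrm x nrm' y \<longleftrightarrow>
    (\<forall>a. finite {i. a i \<noteq> 0} \<longrightarrow>
      1 / sqrt C * nrm' (\<Sum>i | a i \<noteq> 0. a i *\<^sub>R y i) \<le> nrm (\<Sum>i | a i \<noteq> 0. a i *\<^sub>R x i) \<and>
      nrm (\<Sum>i | a i \<noteq> 0. a i *\<^sub>R x i) \<le> sqrt C * nrm' (\<Sum>i | a i \<noteq> 0. a i *\<^sub>R y i))"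

section \<open>The reproduction game\<close>

record 'a step1 =
  tol :: real
  prim_sub :: "'a set"
  dual_sub :: "('a \<Rightarrow> real) set"

record step2 =
  side :: nat
  supp :: "nat set"
  lam :: "nat \<Rightarrow> real"
  mu :: "nat \<Rightarrow> real"

type_synonym step3 = "nat \<Rightarrow> real"

type_synonym 'a turn = "'a step1 \<times> step2 \<times> step3"

text \<open>A strategy of player (II) sees the initial partition, all completed turns and the first step
  of the current turn.\<close>

type_synonym 'a strategy = "nat set \<times> nat set \<Rightarrow> 'a turn list \<Rightarrow> 'a step1 \<Rightarrow> step2"

definition legal_step1 :: "'a::real_vector set \<Rightarrow> ('a \<Rightarrow> real) \<Rightarrow> 'a step1 \<Rightarrow> bool"
  where "legal_step1 V nrm p \<longleftrightarrow>
    tol p > 0 \<and> prim_sub p \<in> cof V nrm \<and> dual_sub p \<in> cof_wstar V nrm"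

definition legal_step2 :: "real \<Rightarrow> nat set \<times> nat set \<Rightarrow> step2 \<Rightarrow> bool"
  where "legal_step2 \<eta> P q \<longleftrightarrow>
    side q \<in> {1, 2} \<and> finite (supp q) \<and>
    supp q \<subseteq> (if side q = 1 then fst P else snd P) \<and>
    (\<forall>i\<in>supp q. 0 \<le> lam q i \<and> 0 \<le> mu q i) \<and>
    1 - \<eta> < (\<Sum>i\<in>supp q. lam q i * mu q i) \<and> (\<Sum>i\<in>supp q. lam q i * mu q i) < 1 + \<eta>"

definition legal_step3 :: "step2 \<Rightarrow> step3 \<Rightarrow> bool"
  where "legal_step3 q \<epsilon> \<longleftrightarrow> \<epsilon> \<in> supp q \<rightarrow>\<^sub>E {-1, 1}"

definition block_vec :: "(nat \<Rightarrow> 'a::real_vector) \<Rightarrow> step2 \<Rightarrow> step3 \<Rightarrow> 'a"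
  where "block_vec e q \<epsilon> = (\<Sum>i\<in>supp q. (\<epsilon> i * lam q i) *\<^sub>R e i)"

definition block_fun ::
    "'a::real_vector set \<Rightarrow> ('a \<Rightarrow> real) \<Rightarrow> (nat \<Rightarrow> 'a) \<Rightarrow> step2 \<Rightarrow> step3 \<Rightarrow> 'a \<Rightarrow> real"
  where "block_fun V nrm e q \<epsilon> = (\<Sum>i\<in>supp q. (\<epsilon> i * mu q i) *\<^sub>R biorth V nrm e i)"

definition rep_win ::
    "'a::real_vector set \<Rightarrow> ('a \<Rightarrow> real) \<Rightarrow> (nat \<Rightarrow> 'a) \<Rightarrow> real \<Rightarrow> real
      \<Rightarrow> (nat \<Rightarrow> 'a step1) \<Rightarrow> (nat \<Rightarrow> step2) \<Rightarrow> (nat \<Rightarrow> step3) \<Rightarrow> bool"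
  where "rep_win V nrm e C \<eta> p q \<epsilon> \<longleftrightarrow>
    impartially_equivalent (C + \<eta>) nrm (\<lambda>k. block_vec e (q k) (\<epsilon> k)) nrm e \<and>
    impartially_equivalent (C + \<eta>)
      (dual_norm V nrm) (\<lambda>k. block_fun V nrm e (q k) (\<epsilon> k))
      (dual_norm V nrm) (biorth V nrm e) \<and>
    (\<forall>k. dist_set nrm (block_vec e (q k) (\<epsilon> k)) (prim_sub (p k)) < tol (p k)) \<and>
    (\<forall>k. dist_set (dual_norm V nrm) (block_fun V nrm e (q k) (\<epsilon> k)) (dual_sub (p k)) < tol (p k))"

definition rep_winning_strategy ::
    "'a::real_vector set \<Rightarrow> ('a \<Rightarrow> real) \<Rightarrow> (nat \<Rightarrow> 'a) \<Rightarrow> real \<Rightarrow> real \<Rightarrow> 'a strategy \<Rightarrow> bool"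
  where "rep_winning_strategy V nrm e C \<eta> \<sigma> \<longleftrightarrow>
    (\<forall>N\<^sub>1 N\<^sub>2 p q \<epsilon>.
      N\<^sub>1 \<union> N\<^sub>2 = UNIV \<longrightarrow> N\<^sub>1 \<inter> N\<^sub>2 = {} \<longrightarrow>
      (\<forall>k. legal_step1 V nrm (p k)) \<longrightarrow>
      (\<forall>k. q k = \<sigma> (N\<^sub>1, N\<^sub>2) (map (\<lambda>j. (p j, q j, \<epsilon> j)) [0..<k]) (p k)) \<longrightarrow>
      (\<forall>k. legal_step3 (q k) (\<epsilon> k)) \<longrightarrow>
      (\<forall>k. legal_step2 \<eta> (N\<^sub>1, N\<^sub>2) (q k)) \<and> rep_win V nrm e C \<eta> p q \<epsilon>)"

text \<open>The first three conjuncts are the standing assumptions under which the game is defined.\<close>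

definition strategically_reproducible ::
    "real \<Rightarrow> 'a::real_vector set \<Rightarrow> ('a \<Rightarrow> real) \<Rightarrow> (nat \<Rightarrow> 'a) \<Rightarrow> bool"
  where "strategically_reproducible C V nrm e \<longleftrightarrow>
    banach_on V nrm \<and> schauder_basis V nrm e \<and> normalized nrm e \<and>
    (\<forall>\<eta>>0. \<exists>\<sigma>. rep_winning_strategy V nrm e C \<eta> \<sigma>)"

section \<open>Direct sums\<close>

definition sum_space ::
    "(nat \<Rightarrow> 'x::banach) \<Rightarrow> (nat \<Rightarrow> 'b::real_vector set) \<Rightarrow> (nat \<Rightarrow> 'b \<Rightarrow> real) \<Rightarrow> (nat \<Rightarrow> 'b) set"
  where "sum_space e Y nrm =
    {z. (\<forall>n. z n \<in> Y n) \<and> summable (\<lambda>n. nrm n (z n) *\<^sub>R e n)}"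

definition sum_norm ::
    "(nat \<Rightarrow> 'x::banach) \<Rightarrow> (nat \<Rightarrow> 'b::real_vector \<Rightarrow> real) \<Rightarrow> (nat \<Rightarrow> 'b) \<Rightarrow> real"
  where "sum_norm e nrm z = norm (\<Sum>n. nrm n (z n) *\<^sub>R e n)"

definition coord_embed :: "nat \<Rightarrow> 'b::real_vector \<Rightarrow> nat \<Rightarrow> 'b"
  where "coord_embed k y = (\<lambda>n. if n = k then y else 0)"

end

theory Submission
  imports Defs
begin

text \<open>Everything rests on the fact that the norm of \<open>Z = (\<Sum> Y\<^sub>n)\<^sub>X\<close> is a monotone function of the norms of the
  coordinates. This is what \<open>1\<close>-unconditionality of \<open>(e\<^sub>n)\<close> provides (\<open>unconditional_mono\<close>,
  \<open>Z_dominated\<close>), and it reduces each claim about \<open>Z\<close> to the same claim about the summands.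

  \<^emph>\<open>The basis.\<close> The enumeration respects the order inside each summand, so among its first \<open>M\<close> vectors
  those from \<open>Y\<^sub>n\<close> form an initial segment of the basis of \<open>Y\<^sub>n\<close>. Hence the \<open>n\<close>-th coordinate of the
  \<open>M\<close>-th partial sum of \<open>z\<close> is itself a partial sum of \<open>z\<^sub>n\<close>, of norm at most \<open>\<lambda> \<parallel>z\<^sub>n\<parallel>\<close>; this gives the
  basis constant. Convergence follows because the coordinatewise errors tend to \<open>0\<close> and are
  dominated by \<open>(1 + \<lambda>) \<parallel>z\<^sub>n\<parallel>\<close>, the coefficients of a convergent series in \<open>X\<close>
  (\<open>unconditional_dominated_convergence\<close>).

  \<^emph>\<open>The game.\<close> If the \<open>m\<close>-th vector of the enumeration is the \<open>i\<close>-th basis vector of \<open>Y\<^sub>n\<close>, player (II)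
  treats turn \<open>m\<close> as turn \<open>i\<close> of a game on \<open>Y\<^sub>n\<close>, following a winning strategy there. The
  opponent's partition and subspaces are pulled back to \<open>Y\<^sub>n\<close> and to its dual, along the embedding of
  \<open>Y\<^sub>n\<close> into \<open>Z\<close> and along \<open>f \<mapsto> f \<circ> P\<^sub>n\<close> for the coordinate projection \<open>P\<^sub>n\<close>. Pulling back preserves
  finite codimension and closedness, and neither map increases norms, so the distances that the
  component strategy makes small remain small in \<open>Z\<close>. Every component game is played to its end, in
  the right order, and is won.

  \<^emph>\<open>The equivalences.\<close> For the vectors, the coordinates of two corresponding linear combinations have
  norms that differ at most by the factor \<open>\<surd>(C + \<eta>)\<close>, and monotonicity of the norm of \<open>Z\<close> applies.
  For the functionals one needs the analogous monotonicity of the dual norm of finite sums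
  \<open>\<Sum> f\<^sub>n \<circ> P\<^sub>n\<close> in the norms \<open>\<parallel>f\<^sub>n\<parallel>\<close> (\<open>dual_norm_sum_mono\<close>). It holds because the coordinates of a vector
  can be replaced, one independently of the other, by vectors of no larger norm on which the given
  functionals are almost norming.\<close>

lemma scaleR_fun_apply [simp]: "(c *\<^sub>R f) x = c *\<^sub>R f x"
  by (simp add: scaleR_fun_def)

lemma sum_fun_apply [simp]: "(\<Sum>i\<in>A. f i) x = (\<Sum>i\<in>A. f i x)"
  by (induction A rule: infinite_finite_induct) auto

section \<open>Norms on a linear subspace\<close>

locale normed_subspace =
  fixes V :: "'a::real_vector set" and nrm :: "'a \<Rightarrow> real"
  assumes subspace: "subspace V" and norm_on: "norm_on V nrm"
begin

lemma norm_nonneg: "x \<in> V \<Longrightarrow> 0 \<le> nrm x"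
  and norm_eq_0_iff: "x \<in> V \<Longrightarrow> nrm x = 0 \<longleftrightarrow> x = 0"
  and norm_scaleR: "x \<in> V \<Longrightarrow> nrm (c *\<^sub>R x) = \<bar>c\<bar> * nrm x"
  and norm_triangle: "x \<in> V \<Longrightarrow> y \<in> V \<Longrightarrow> nrm (x + y) \<le> nrm x + nrm y"
  using norm_on by (auto simp: norm_on_def)

lemma zero_mem: "0 \<in> V"
  and add_mem: "x \<in> V \<Longrightarrow> y \<in> V \<Longrightarrow> x + y \<in> V"
  and diff_mem: "x \<in> V \<Longrightarrow> y \<in> V \<Longrightarrow> x - y \<in> V"
  and scaleR_mem: "x \<in> V \<Longrightarrow> c *\<^sub>R x \<in> V"
  and sum_mem: "(\<And>i. i \<in> A \<Longrightarrow> f i \<in> V) \<Longrightarrow> sum f A \<in> V"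
  using subspace by (auto intro: subspace_0 subspace_add subspace_diff subspace_scale subspace_sum)

lemma norm_zero: "nrm 0 = 0"
  using norm_eq_0_iff zero_mem by blast

lemma norm_minus_commute: "x \<in> V \<Longrightarrow> y \<in> V \<Longrightarrow> nrm (x - y) = nrm (y - x)"
  using norm_scaleR[of "y - x" "-1"] by (simp add: diff_mem)

lemma norm_triangle_diff: "x \<in> V \<Longrightarrow> y \<in> V \<Longrightarrow> nrm (x - y) \<le> nrm x + nrm y"
  using norm_triangle[of x "(-1) *\<^sub>R y"] norm_scaleR[of y "-1"] scaleR_mem[of y "-1"] by simp

lemma norm_triangle_via: "x \<in> V \<Longrightarrow> y \<in> V \<Longrightarrow> z \<in> V \<Longrightarrow> nrm (x - z) \<le> nrm (x - y) + nrm (y - z)"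
  using norm_triangle[of "x - y" "y - z"] by (simp add: diff_mem)

lemma norm_diff_abs_le: "x \<in> V \<Longrightarrow> y \<in> V \<Longrightarrow> \<bar>nrm x - nrm y\<bar> \<le> nrm (x - y)"
  using norm_triangle[of "x - y" y] norm_triangle[of "y - x" x]
  by (simp add: diff_mem norm_minus_commute abs_le_iff)

sublocale Metric_space V "norm_dist V nrm"
proof
  fix x y z
  show "0 \<le> norm_dist V nrm x y"
    by (simp add: norm_dist_def norm_nonneg diff_mem)
  show "norm_dist V nrm x y = norm_dist V nrm y x"
    by (simp add: norm_dist_def norm_minus_commute)
  show "x \<in> V \<Longrightarrow> y \<in> V \<Longrightarrow> norm_dist V nrm x y = 0 \<longleftrightarrow> x = y"
    by (simp add: norm_dist_def norm_eq_0_iff diff_mem)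
  show "x \<in> V \<Longrightarrow> y \<in> V \<Longrightarrow> z \<in> V \<Longrightarrow>
      norm_dist V nrm x z \<le> norm_dist V nrm x y + norm_dist V nrm y z"
    by (simp add: norm_dist_def norm_triangle_via)
qed

text \<open>Completeness and closedness are defined through the abstract topology of \<^const>\<open>norm_dist\<close>. This
  lemma and the two characterisations \<open>mcomplete_norm_iff\<close> and \<open>closedin_norm_iff\<close> replace that
  topology by sequences converging in norm.\<close>

lemma limitin_norm_iff:
  assumes "\<And>k. \<sigma> k \<in> V"
  shows "limitin mtopology \<sigma> l sequentially \<longleftrightarrow> l \<in> V \<and> (\<lambda>k. nrm (\<sigma> k - l)) \<longlonglongrightarrow> 0"
proof (cases "l \<in> V")
  case True
  then have "norm_dist V nrm (\<sigma> k) l = nrm (\<sigma> k - l)" "\<bar>nrm (\<sigma> k - l)\<bar> = nrm (\<sigma> k - l)" for k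
    using assms by (simp_all add: norm_dist_def norm_nonneg diff_mem)
  then show ?thesis
    using True assms
    by (simp add: limitin_metric lim_sequentially eventually_sequentially dist_real_def)
qed (simp add: limitin_metric)

lemma mcomplete_norm_iff:
  "mcomplete \<longleftrightarrow> (\<forall>\<sigma>. (\<forall>k. \<sigma> k \<in> V) \<longrightarrow>
     (\<forall>\<epsilon>>0. \<exists>K. \<forall>k\<ge>K. \<forall>l\<ge>K. nrm (\<sigma> k - \<sigma> l) < \<epsilon>) \<longrightarrow>
     (\<exists>x\<in>V. (\<lambda>k. nrm (\<sigma> k - x)) \<longlonglongrightarrow> 0))"
proof -
  have C: "MCauchy \<sigma> \<longleftrightarrow> (\<forall>k. \<sigma> k \<in> V) \<and>
      (\<forall>\<epsilon>>0. \<exists>K. \<forall>k\<ge>K. \<forall>l\<ge>K. nrm (\<sigma> k - \<sigma> l) < \<epsilon>)" for \<sigma>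
  proof (cases "\<forall>k. \<sigma> k \<in> V")
    case True
    then show ?thesis
      by (simp add: MCauchy_def norm_dist_def image_subset_iff)
  qed (auto simp: MCauchy_def)
  have L: "(\<exists>l. limitin mtopology \<sigma> l sequentially) \<longleftrightarrow> (\<exists>x\<in>V. (\<lambda>k. nrm (\<sigma> k - x)) \<longlonglongrightarrow> 0)"
    if "\<forall>k. \<sigma> k \<in> V" for \<sigma>
    using limitin_norm_iff[of \<sigma>] that by auto
  have "(MCauchy \<sigma> \<longrightarrow> (\<exists>l. limitin mtopology \<sigma> l sequentially)) \<longleftrightarrow>
      ((\<forall>k. \<sigma> k \<in> V) \<longrightarrow> (\<forall>\<epsilon>>0. \<exists>K. \<forall>k\<ge>K. \<forall>l\<ge>K. nrm (\<sigma> k - \<sigma> l) < \<epsilon>) \<longrightarrow>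
        (\<exists>x\<in>V. (\<lambda>k. nrm (\<sigma> k - x)) \<longlonglongrightarrow> 0))" for \<sigma>
  proof -
    have "(M \<longrightarrow> E) = (A \<longrightarrow> B \<longrightarrow> F)" if "M = (A \<and> B)" "A \<Longrightarrow> E = F" for M A B E F
      using that by blast
    then show ?thesis using C L .
  qed
  then show ?thesis
    unfolding mcomplete_def by (rule iff_allI)
qed

lemma closedin_norm_iff:
  "closedin mtopology W \<longleftrightarrow> W \<subseteq> V \<and>
     (\<forall>\<sigma>. \<forall>l\<in>V. (\<forall>k. \<sigma> k \<in> W) \<longrightarrow> (\<lambda>k. nrm (\<sigma> k - l)) \<longlonglongrightarrow> 0 \<longrightarrow> l \<in> W)"
  unfolding metric_closedin_iff_sequentially_closed
proof (cases "W \<subseteq> V")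
  case True
  then have "limitin mtopology \<sigma> l sequentially \<longleftrightarrow> l \<in> V \<and> (\<lambda>k. nrm (\<sigma> k - l)) \<longlonglongrightarrow> 0"
    if "range \<sigma> \<subseteq> W" for \<sigma> l
    using that by (intro limitin_norm_iff) auto
  moreover have "range \<sigma> \<subseteq> W \<longleftrightarrow> (\<forall>k. \<sigma> k \<in> W)" for \<sigma> :: "nat \<Rightarrow> 'a"
    by auto
  ultimately show "(W \<subseteq> V \<and> (\<forall>\<sigma> l. range \<sigma> \<subseteq> W \<and> limitin mtopology \<sigma> l sequentially \<longrightarrow> l \<in> W)) \<longleftrightarrow>
      (W \<subseteq> V \<and> (\<forall>\<sigma>. \<forall>l\<in>V. (\<forall>k. \<sigma> k \<in> W) \<longrightarrow> (\<lambda>k. nrm (\<sigma> k - l)) \<longlonglongrightarrow> 0 \<longrightarrow> l \<in> W))"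
    by blast
qed auto

lemma dual_subspace: "subspace (dual V nrm)"
proof (rule subspaceI)
  show "0 \<in> dual V nrm"
    by (auto simp: dual_def intro: exI[of _ 0])
next
  fix f g assume f: "f \<in> dual V nrm" and g: "g \<in> dual V nrm"
  obtain B B' where "\<forall>x\<in>V. \<bar>f x\<bar> \<le> B * nrm x" "\<forall>x\<in>V. \<bar>g x\<bar> \<le> B' * nrm x"
    using f g by (auto simp: dual_def)
  then have "\<forall>x\<in>V. \<bar>f x + g x\<bar> \<le> (B + B') * nrm x"
    by (force simp: distrib_right)
  then have "\<exists>B. \<forall>x\<in>V. \<bar>f x + g x\<bar> \<le> B * nrm x" ..
  then show "f + g \<in> dual V nrm"
    using f g by (simp add: dual_def algebra_simps)
next
  fix c f assume f: "f \<in> dual V nrm"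
  then obtain B where "\<forall>x\<in>V. \<bar>f x\<bar> \<le> B * nrm x" by (auto simp: dual_def)
  then have "\<forall>x\<in>V. \<bar>c * f x\<bar> \<le> (\<bar>c\<bar> * B) * nrm x"
    by (auto simp: abs_mult mult.assoc intro!: mult_left_mono)
  then have "\<exists>B. \<forall>x\<in>V. \<bar>c * f x\<bar> \<le> B * nrm x" ..
  then show "c *\<^sub>R f \<in> dual V nrm"
    using f by (simp add: dual_def algebra_simps)
qed

lemma dual_norm_bdd:
  assumes "f \<in> dual V nrm"
  shows "bdd_above ((\<lambda>x. \<bar>f x\<bar>) ` {x \<in> V. nrm x \<le> 1})"
proof -
  obtain B where B: "\<forall>x\<in>V. \<bar>f x\<bar> \<le> B * nrm x" using assms by (auto simp: dual_def)
  have "\<bar>f x\<bar> \<le> \<bar>B\<bar>" if "x \<in> V" "nrm x \<le> 1" for x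
  proof -
    have "\<bar>f x\<bar> \<le> \<bar>B\<bar> * nrm x"
      using B that norm_nonneg[of x] by (meson abs_ge_self mult_right_mono order_trans)
    also have "\<dots> \<le> \<bar>B\<bar> * 1"
      using that by (intro mult_left_mono) auto
    finally show ?thesis by simp
  qed
  then show ?thesis by (intro bdd_aboveI[of _ "\<bar>B\<bar>"]) auto
qed

lemma abs_le_dual_norm_unit:
  "f \<in> dual V nrm \<Longrightarrow> x \<in> V \<Longrightarrow> nrm x \<le> 1 \<Longrightarrow> \<bar>f x\<bar> \<le> dual_norm V nrm f"
  unfolding dual_norm_def by (rule cSUP_upper) (auto intro: dual_norm_bdd)

lemma dual_norm_nonneg: "f \<in> dual V nrm \<Longrightarrow> 0 \<le> dual_norm V nrm f"
  using abs_le_dual_norm_unit[of f 0] zero_mem norm_zero by force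

lemma abs_le_dual_norm:
  assumes f: "f \<in> dual V nrm" and x: "x \<in> V"
  shows "\<bar>f x\<bar> \<le> dual_norm V nrm f * nrm x"
proof (cases "x = 0")
  case True
  have "f (0 *\<^sub>R x) = 0 * f x" using f x unfolding dual_def by blast
  then show ?thesis using True norm_zero by simp
next
  case False
  then have pos: "0 < nrm x" using norm_nonneg norm_eq_0_iff x by (simp add: less_le)
  have "\<bar>f ((1 / nrm x) *\<^sub>R x)\<bar> \<le> dual_norm V nrm f"
    using pos x by (intro abs_le_dual_norm_unit f) (auto simp: scaleR_mem norm_scaleR)
  moreover have "f ((1 / nrm x) *\<^sub>R x) = 1 / nrm x * f x"
    using f x unfolding dual_def by blast
  ultimately show ?thesis
    using pos by (simp add: abs_mult field_simps)
qed

lemma dual_norm_le: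
  assumes "\<And>x. x \<in> V \<Longrightarrow> nrm x \<le> 1 \<Longrightarrow> \<bar>f x\<bar> \<le> B"
  shows "dual_norm V nrm f \<le> B"
  unfolding dual_norm_def using assms zero_mem norm_zero by (intro cSUP_least) auto

lemma dual_norm_nearly_attained:
  assumes f: "f \<in> dual V nrm" and "c < dual_norm V nrm f"
  obtains x where "x \<in> V" "nrm x \<le> 1" "c < f x"
proof -
  obtain x where x: "x \<in> V" "nrm x \<le> 1" "c < \<bar>f x\<bar>"
    using assms(2) zero_mem norm_zero unfolding dual_norm_def
    by (subst (asm) less_cSUP_iff) (auto intro: dual_norm_bdd f)
  show ?thesis
  proof (cases "c < f x")
    case False
    have "f ((-1) *\<^sub>R x) = (-1) * f x"
      using f x(1) unfolding dual_def by blast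
    then have "c < f ((-1) *\<^sub>R x)" using False x(3) by linarith
    moreover have "nrm ((-1) *\<^sub>R x) \<le> 1" using norm_scaleR[of x "-1"] x by simp
    ultimately show ?thesis using that scaleR_mem[OF x(1), of "-1"] by blast
  qed (use x that in blast)
qed

lemma dist_set_le:
  assumes "x \<in> V" "W \<subseteq> V" "w \<in> W"
  shows "dist_set nrm x W \<le> nrm (x - w)"
  unfolding dist_set_def
proof (rule cINF_lower)
  have "0 \<le> nrm (x - w)" if "w \<in> W" for w
    using that assms by (intro norm_nonneg diff_mem) auto
  then show "bdd_below ((\<lambda>w. nrm (x - w)) ` W)"
    by (intro bdd_belowI2)
qed (rule assms)

end

lemma dist_set_lessE:
  assumes "W \<noteq> {}" "dist_set nrm x W < t"
  obtains w where "w \<in> W" "nrm (x - w) < t"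
  using cInf_lessD[of "(\<lambda>w. nrm (x - w)) ` W" t] assms unfolding dist_set_def by auto

lemma normed_subspace_dual:
  assumes "normed_subspace V nrm"
  shows "normed_subspace (dual V nrm) (dual_norm V nrm)"
proof -
  interpret normed_subspace V nrm by fact
  show ?thesis
  proof
    show "subspace (dual V nrm)" by (rule dual_subspace)
    have "dual_norm V nrm 0 = 0"
      using dual_norm_le[of 0 0] dual_norm_nonneg[of 0] subspace_0[OF dual_subspace] by force
    moreover have "f = 0" if f: "f \<in> dual V nrm" "dual_norm V nrm f = 0" for f
    proof
      fix x
      show "f x = 0 x"
        using abs_le_dual_norm[of f x] f by (cases "x \<in> V") (auto simp: dual_def)
    qed
    moreover have scale: "dual_norm V nrm (c *\<^sub>R f) \<le> \<bar>c\<bar> * dual_norm V nrm f"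
      if "f \<in> dual V nrm" for c f
      using that by (intro dual_norm_le) (auto simp: abs_mult intro!: mult_left_mono abs_le_dual_norm_unit)
    moreover have "\<bar>c\<bar> * dual_norm V nrm f \<le> dual_norm V nrm (c *\<^sub>R f)"
      if f: "f \<in> dual V nrm" for c f
    proof (cases "c = 0")
      case True
      then show ?thesis using dual_norm_nonneg[OF subspace_scale[OF dual_subspace f, of c]] by simp
    next
      case False
      then show ?thesis
        using scale[OF subspace_scale[OF dual_subspace f], of "1 / c" c] by (simp add: field_simps)
    qed
    moreover have "dual_norm V nrm (f + g) \<le> dual_norm V nrm f + dual_norm V nrm g"
      if "f \<in> dual V nrm" "g \<in> dual V nrm" for f g
    proof (rule dual_norm_le)
      fix x assume "x \<in> V" "nrm x \<le> 1"
      then show "\<bar>(f + g) x\<bar> \<le> dual_norm V nrm f + dual_norm V nrm g"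
        using abs_le_dual_norm_unit[of f x] abs_le_dual_norm_unit[of g x] that by simp
    qed
    ultimately show "norm_on (dual V nrm) (dual_norm V nrm)"
      unfolding norm_on_def using dual_norm_nonneg
      by (intro conjI ballI allI antisym) auto
  qed
qed

section \<open>Schauder bases\<close>

locale schauder_space = normed_subspace V nrm
  for V :: "'a::real_vector set" and nrm :: "'a \<Rightarrow> real" +
  fixes b :: "nat \<Rightarrow> 'a" and K :: real
  assumes basis: "schauder_basis V nrm b"
    and normalized: "normalized nrm b"
    and basis_constant_le: "basis_constant V nrm b \<le> ereal K"
begin

lemma basis_mem: "b i \<in> V"
  using basis by (simp add: schauder_basis_def)

lemma norm_basis: "nrm (b i) = 1"
  using normalized by (simp add: normalized_def)

definition partial_sum :: "nat \<Rightarrow> 'a \<Rightarrow> 'a"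
  where "partial_sum k x = (\<Sum>i<k. biorth V nrm b i x *\<^sub>R b i)"

lemma partial_sum_mem: "partial_sum k x \<in> V"
  unfolding partial_sum_def by (intro sum_mem scaleR_mem basis_mem)

lemma biorth_eqI:
  assumes "x \<in> V" "basis_expansion nrm b x a"
  shows "biorth V nrm b i x = a i"
proof -
  have "\<exists>!a. basis_expansion nrm b x a" using basis assms(1) by (simp add: schauder_basis_def)
  then have "(THE a. basis_expansion nrm b x a) = a"
    using the1_equality[of "basis_expansion nrm b x" a] assms(2) by simp
  then show ?thesis using assms(1) by (simp add: biorth_def)
qed

lemma basis_expansion_biorth:
  assumes "x \<in> V"
  shows "basis_expansion nrm b x (\<lambda>i. biorth V nrm b i x)"
proof -
  obtain a where a: "basis_expansion nrm b x a"
    using basis assms by (auto simp: schauder_basis_def)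
  then have "a = (\<lambda>i. biorth V nrm b i x)" using biorth_eqI[OF assms] by auto
  then show ?thesis using a by simp
qed

lemma partial_sum_tendsto: "x \<in> V \<Longrightarrow> (\<lambda>k. nrm (x - partial_sum k x)) \<longlonglongrightarrow> 0"
  using basis_expansion_biorth by (simp add: basis_expansion_def partial_sum_def)

lemma biorth_add:
  assumes "x \<in> V" "y \<in> V"
  shows "biorth V nrm b i (x + y) = biorth V nrm b i x + biorth V nrm b i y"
proof (rule biorth_eqI)
  let ?u = "\<lambda>k. x - partial_sum k x" and ?v = "\<lambda>k. y - partial_sum k y"
  have lim: "(\<lambda>k. nrm (?u k) + nrm (?v k)) \<longlonglongrightarrow> 0"
    using tendsto_add[OF partial_sum_tendsto partial_sum_tendsto, OF assms] by simp
  have "nrm (?u k + ?v k) \<le> nrm (?u k) + nrm (?v k)" "0 \<le> nrm (?u k + ?v k)" for k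
    using assms by (auto intro!: norm_triangle norm_nonneg diff_mem add_mem partial_sum_mem)
  then have "(\<lambda>k. nrm (?u k + ?v k)) \<longlonglongrightarrow> 0"
    by (intro tendsto_sandwich[OF _ _ tendsto_const lim]) (auto intro: always_eventually)
  moreover have "?u k + ?v k =
      (x + y) - (\<Sum>i<k. (biorth V nrm b i x + biorth V nrm b i y) *\<^sub>R b i)" for k
    by (simp add: partial_sum_def scaleR_add_left sum.distrib algebra_simps)
  ultimately show "basis_expansion nrm b (x + y) (\<lambda>i. biorth V nrm b i x + biorth V nrm b i y)"
    by (simp add: basis_expansion_def)
qed (use assms add_mem in auto)

lemma biorth_scaleR:
  assumes "x \<in> V"
  shows "biorth V nrm b i (c *\<^sub>R x) = c * biorth V nrm b i x"
proof (rule biorth_eqI)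
  have "(\<lambda>k. \<bar>c\<bar> * nrm (x - partial_sum k x)) \<longlonglongrightarrow> \<bar>c\<bar> * 0"
    by (intro tendsto_mult_left partial_sum_tendsto assms)
  moreover have "\<bar>c\<bar> * nrm (x - partial_sum k x) =
      nrm (c *\<^sub>R x - (\<Sum>i<k. (c * biorth V nrm b i x) *\<^sub>R b i))" for k
  proof -
    have "c *\<^sub>R x - (\<Sum>i<k. (c * biorth V nrm b i x) *\<^sub>R b i) = c *\<^sub>R (x - partial_sum k x)"
      by (simp add: partial_sum_def scaleR_right_diff_distrib scaleR_sum_right)
    then show ?thesis
      using assms by (simp add: diff_mem partial_sum_mem norm_scaleR)
  qed
  ultimately show "basis_expansion nrm b (c *\<^sub>R x) (\<lambda>i. c * biorth V nrm b i x)"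
    by (simp add: basis_expansion_def)
qed (use assms scaleR_mem in auto)

lemma partial_sum_scaleR: "x \<in> V \<Longrightarrow> partial_sum k (c *\<^sub>R x) = c *\<^sub>R partial_sum k x"
  by (simp add: partial_sum_def biorth_scaleR scaleR_sum_right)

lemma norm_partial_sum_le:
  assumes x: "x \<in> V"
  shows "nrm (partial_sum k x) \<le> K * nrm x"
proof (cases "x = 0")
  case True
  then show ?thesis
    using partial_sum_scaleR[of x k 0] x norm_zero by simp
next
  case False
  then have pos: "0 < nrm x" using norm_nonneg norm_eq_0_iff x by (simp add: less_le)
  let ?y = "(1 / nrm x) *\<^sub>R x"
  have y: "?y \<in> V" "nrm ?y \<le> 1" using pos x by (auto simp: scaleR_mem norm_scaleR)
  have "ereal (nrm (partial_sum k ?y)) \<le> basis_constant V nrm b"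
    unfolding basis_constant_def partial_sum_def using y by (intro SUP_upper2[of k] SUP_upper) auto
  also have "\<dots> \<le> ereal K" by (rule basis_constant_le)
  finally have "nrm (partial_sum k ?y) \<le> K" by simp
  then show ?thesis
    using pos x by (simp add: partial_sum_scaleR norm_scaleR partial_sum_mem field_simps)
qed

text \<open>As the basis is normalized, the modulus of a coefficient is the norm of the difference of two
  consecutive partial sums.\<close>

lemma abs_biorth_le:
  assumes "x \<in> V"
  shows "\<bar>biorth V nrm b i x\<bar> \<le> 2 * K * nrm x"
proof -
  have "\<bar>biorth V nrm b i x\<bar> = nrm (biorth V nrm b i x *\<^sub>R b i)"
    by (simp add: norm_scaleR basis_mem norm_basis)
  also have "biorth V nrm b i x *\<^sub>R b i = partial_sum (Suc i) x - partial_sum i x"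
    by (simp add: partial_sum_def)
  also have "nrm \<dots> \<le> K * nrm x + K * nrm x"
    using norm_triangle_diff[OF partial_sum_mem partial_sum_mem, of "Suc i" x i x]
      norm_partial_sum_le[OF assms, of i] norm_partial_sum_le[OF assms, of "Suc i"] by linarith
  finally show ?thesis by simp
qed

lemma biorth_mem_dual: "biorth V nrm b i \<in> dual V nrm"
  unfolding dual_def using biorth_add biorth_scaleR abs_biorth_le
  by (auto simp: biorth_def intro!: exI[of _ "2 * K"])

end

section \<open>Unconditional bases as lattices\<close>

text \<open>Changing one coefficient \<open>c\<close> to \<open>t c\<close> with \<open>\<bar>t\<bar> \<le> 1\<close> turns the vector into a convex combination of itself
  and its reflection in that coordinate, and the reflection has no larger norm. The coefficients are
  shrunk in this way one at a time.\<close>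

lemma unconditional_mono_initial:
  fixes e :: "nat \<Rightarrow> 'x::real_normed_vector"
  assumes unc: "unconditional 1 norm e" and le: "\<And>i. i < n \<Longrightarrow> \<bar>a i\<bar> \<le> \<bar>c i\<bar>"
  shows "norm (\<Sum>i<n. a i *\<^sub>R e i) \<le> norm (\<Sum>i<n. c i *\<^sub>R e i)"
proof -
  define v where "v m i = (if i < m then a i else c i)" for m i :: nat
  have "norm (\<Sum>i<n. v m i *\<^sub>R e i) \<le> norm (\<Sum>i<n. c i *\<^sub>R e i)" if "m \<le> n" for m
    using that
  proof (induction m)
    case 0
    then show ?case by (simp add: v_def)
  next
    case (Suc m)
    have "\<exists>t. \<bar>t\<bar> \<le> 1 \<and> a m = t * c m"
    proof (cases "c m = 0")
      case True
      then show ?thesis using le[of m] Suc.prems by (intro exI[of _ 0]) auto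
    next
      case False
      then show ?thesis using le[of m] Suc.prems
        by (intro exI[of _ "a m / c m"]) (auto simp: field_simps)
    qed
    then obtain t where t: "\<bar>t\<bar> \<le> 1" "a m = t * c m" by blast
    \<comment> \<open>the reflection in coordinate \<open>m\<close>\<close>
    define s where "s i = (if i = m then -1 else 1 :: real)" for i
    let ?x = "\<Sum>i<n. v m i *\<^sub>R e i" and ?y = "\<Sum>i<n. (s i * v m i) *\<^sub>R e i"
    have y: "norm ?y \<le> norm ?x"
      using unc by (force simp: unconditional_def s_def)
    have "v (Suc m) i = (1 + t) / 2 * v m i + (1 - t) / 2 * (s i * v m i)" for i
      using t by (auto simp: v_def s_def less_Suc_eq field_simps)
    then have "(\<Sum>i<n. v (Suc m) i *\<^sub>R e i) = ((1 + t) / 2) *\<^sub>R ?x + ((1 - t) / 2) *\<^sub>R ?y"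
      by (simp add: scaleR_add_left sum.distrib scaleR_sum_right)
    also have "norm \<dots> \<le> (1 + t) / 2 * norm ?x + (1 - t) / 2 * norm ?y"
      using t by (intro order_trans[OF norm_triangle_ineq]) simp
    also have "\<dots> \<le> (1 + t) / 2 * norm ?x + (1 - t) / 2 * norm ?x"
      using t y by (intro add_left_mono mult_left_mono) auto
    also have "\<dots> = norm ?x" by (simp add: field_simps)
    finally show ?case using Suc by simp
  qed
  from this[of n] show ?thesis by (simp add: v_def)
qed

lemma unconditional_mono:
  fixes e :: "nat \<Rightarrow> 'x::real_normed_vector"
  assumes unc: "unconditional 1 norm e" and B: "finite B" "A \<subseteq> B"
    and le: "\<And>i. i \<in> A \<Longrightarrow> \<bar>a i\<bar> \<le> \<bar>c i\<bar>"
  shows "norm (\<Sum>i\<in>A. a i *\<^sub>R e i) \<le> norm (\<Sum>i\<in>B. c i *\<^sub>R e i)"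
proof -
  obtain n where n: "B \<subseteq> {..<n}" using finite_nat_iff_bounded B by blast
  have ext: "(\<Sum>i\<in>S. u i *\<^sub>R e i) = (\<Sum>i<n. (if i \<in> S then u i else 0) *\<^sub>R e i)"
    if "S \<subseteq> B" for S u
    using that n by (intro sum.mono_neutral_cong_left) auto
  show ?thesis
    unfolding ext[OF B(2)] ext[OF order_refl] using B(2) le
    by (intro unconditional_mono_initial[OF unc]) auto
qed

lemma unconditional_summable:
  fixes e :: "nat \<Rightarrow> 'x::banach"
  assumes unc: "unconditional 1 norm e" and c: "summable (\<lambda>n. c n *\<^sub>R e n)"
    and le: "\<And>n. \<bar>a n\<bar> \<le> \<bar>c n\<bar>"
  shows "summable (\<lambda>n. a n *\<^sub>R e n)"
proof -
  have "norm (\<Sum>i\<in>{m..<n}. a i *\<^sub>R e i) \<le> norm (\<Sum>i\<in>{m..<n}. c i *\<^sub>R e i)" for m n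
    by (intro unconditional_mono[OF unc] le) auto
  then show ?thesis
    using c unfolding summable_Cauchy by (meson le_less_trans)
qed

lemma norm_suminf_le:
  fixes f :: "nat \<Rightarrow> 'x::real_normed_vector"
  assumes "summable f" "\<And>n. n \<ge> M \<Longrightarrow> norm (\<Sum>i<n. f i) \<le> B"
  shows "norm (suminf f) \<le> B"
  using tendsto_norm[OF summable_LIMSEQ[OF assms(1)]] assms(2)
  by (intro Lim_bounded[where M = M]) auto

lemma unconditional_sum_le_suminf:
  fixes e :: "nat \<Rightarrow> 'x::banach"
  assumes unc: "unconditional 1 norm e" and c: "summable (\<lambda>n. c n *\<^sub>R e n)"
    and A: "finite A" and le: "\<And>n. n \<in> A \<Longrightarrow> \<bar>a n\<bar> \<le> \<bar>c n\<bar>"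
  shows "norm (\<Sum>n\<in>A. a n *\<^sub>R e n) \<le> norm (\<Sum>n. c n *\<^sub>R e n)"
proof -
  obtain M where M: "A \<subseteq> {..<M}" using finite_nat_iff_bounded A by blast
  show ?thesis
  proof (rule Lim_bounded2[OF tendsto_norm[OF summable_LIMSEQ[OF c]], of M], intro allI impI)
    fix n assume "M \<le> n"
    then show "norm (\<Sum>n\<in>A. a n *\<^sub>R e n) \<le> norm (\<Sum>i<n. c i *\<^sub>R e i)"
      using M by (intro unconditional_mono[OF unc] le) auto
  qed
qed

lemma unconditional_suminf_mono:
  fixes e :: "nat \<Rightarrow> 'x::banach"
  assumes unc: "unconditional 1 norm e" and c: "summable (\<lambda>n. c n *\<^sub>R e n)"
    and le: "\<And>n. \<bar>a n\<bar> \<le> \<bar>c n\<bar>"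
  shows "norm (\<Sum>n. a n *\<^sub>R e n) \<le> norm (\<Sum>n. c n *\<^sub>R e n)"
  using unconditional_summable[OF assms]
  by (rule norm_suminf_le) (intro unconditional_sum_le_suminf[OF unc c] le, simp)

text \<open>The tails of the dominating series are uniformly small, and on the remaining finitely many
  coordinates pointwise convergence suffices.\<close>

lemma unconditional_dominated_convergence:
  fixes e :: "nat \<Rightarrow> 'x::banach"
  assumes unc: "unconditional 1 norm e" and c: "summable (\<lambda>n. c n *\<^sub>R e n)"
    and le: "\<And>m n. \<bar>a m n\<bar> \<le> \<bar>c n\<bar>" and lim: "\<And>n. (\<lambda>m. a m n) \<longlonglongrightarrow> 0"
  shows "(\<lambda>m. norm (\<Sum>n. a m n *\<^sub>R e n)) \<longlonglongrightarrow> 0"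
proof (rule LIMSEQ_I)
  fix r :: real assume r: "0 < r"
  have sm: "summable (\<lambda>n. a m n *\<^sub>R e n)" for m
    by (rule unconditional_summable[OF unc c le])
  obtain M where M: "norm (\<Sum>i\<in>{M..<n}. c i *\<^sub>R e i) < r / 3" for n
    using c r unfolding summable_Cauchy by (metis divide_pos_pos order_refl zero_less_numeral)
  have "(\<lambda>m. norm (\<Sum>n<M. a m n *\<^sub>R e n)) \<longlonglongrightarrow> norm (\<Sum>n<M. 0 *\<^sub>R e n)"
    by (intro tendsto_intros lim)
  then have "(\<lambda>m. norm (\<Sum>n<M. a m n *\<^sub>R e n)) \<longlonglongrightarrow> 0" by simp
  then obtain m0 where m0: "norm (\<Sum>n<M. a m n *\<^sub>R e n) < r / 3" if "m \<ge> m0" for m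
    using LIMSEQ_D[of _ 0 "r / 3"] r by fastforce
  have "norm (\<Sum>n. a m n *\<^sub>R e n) \<le> 2 * (r / 3)" if m: "m \<ge> m0" for m
  proof (rule norm_suminf_le[OF sm, of M])
    fix n assume "M \<le> n"
    then have "(\<Sum>i<n. a m i *\<^sub>R e i) = (\<Sum>i<M. a m i *\<^sub>R e i) + (\<Sum>i\<in>{M..<n}. a m i *\<^sub>R e i)"
      by (metis atLeast0LessThan le0 sum.atLeastLessThan_concat)
    also have "norm \<dots> \<le> norm (\<Sum>i<M. a m i *\<^sub>R e i) + norm (\<Sum>i\<in>{M..<n}. a m i *\<^sub>R e i)"
      by (rule norm_triangle_ineq)
    also have "\<dots> \<le> r / 3 + norm (\<Sum>i\<in>{M..<n}. c i *\<^sub>R e i)"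
      using m0[OF m] by (intro add_mono unconditional_mono[OF unc] le) auto
    also have "\<dots> \<le> 2 * (r / 3)" using M[of n] by simp
    finally show "norm (\<Sum>i<n. a m i *\<^sub>R e i) \<le> 2 * (r / 3)" .
  qed
  then show "\<exists>m0. \<forall>m\<ge>m0. norm (norm (\<Sum>n. a m n *\<^sub>R e n) - 0) < r"
    using r by (intro exI[of _ m0]) (force intro: le_less_trans)
qed

section \<open>The direct sum\<close>

locale direct_sum =
  fixes e :: "nat \<Rightarrow> 'x::banach" and Y :: "nat \<Rightarrow> 'b::real_vector set" and nrm :: "nat \<Rightarrow> 'b \<Rightarrow> real"
  assumes normalized_e: "normalized norm e" and unconditional_e: "unconditional 1 norm e"
    and banach_Y: "\<And>n. banach_on (Y n) (nrm n)"
begin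

abbreviation Z :: "(nat \<Rightarrow> 'b) set" where "Z \<equiv> sum_space e Y nrm"
abbreviation Znorm :: "(nat \<Rightarrow> 'b) \<Rightarrow> real" where "Znorm \<equiv> sum_norm e nrm"

sublocale comp: normed_subspace "Y n" "nrm n" for n
  using banach_Y[of n] by unfold_locales (auto simp: banach_on_def)

lemma norm_e: "norm (e n) = 1"
  using normalized_e by (simp add: normalized_def)

lemma mem_Z_iff: "z \<in> Z \<longleftrightarrow> (\<forall>n. z n \<in> Y n) \<and> summable (\<lambda>n. nrm n (z n) *\<^sub>R e n)"
  by (simp add: sum_space_def)

lemma coord_mem: "z \<in> Z \<Longrightarrow> z n \<in> Y n"
  by (simp add: mem_Z_iff)

lemma Znorm_nonneg: "0 \<le> Znorm z"
  by (simp add: sum_norm_def)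

text \<open>Monotonicity of the norm of \<open>X\<close>, applied to the sequence of the norms of the coordinates. The bound
  for the basis constant and the comparison of blocks with basis vectors are instances of this.\<close>

lemma Z_dominated:
  assumes z: "z \<in> Z" and w: "\<And>n. w n \<in> Y n" and le: "\<And>n. nrm n (w n) \<le> D * nrm n (z n)"
    and D: "0 \<le> D"
  shows "w \<in> Z" "Znorm w \<le> D * Znorm z"
proof -
  have s: "summable (\<lambda>n. (D * nrm n (z n)) *\<^sub>R e n)"
    using summable_scaleR_right[of "\<lambda>n. nrm n (z n) *\<^sub>R e n" D] z by (simp add: mem_Z_iff)
  have "\<bar>nrm n (w n)\<bar> \<le> \<bar>D * nrm n (z n)\<bar>" for n
    using le[of n] comp.norm_nonneg[OF w, of n] by simp
  note * = unconditional_e s this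
  show "w \<in> Z" using unconditional_summable[OF *] w by (simp add: mem_Z_iff)
  have "norm (\<Sum>n. (D * nrm n (z n)) *\<^sub>R e n) = D * Znorm z"
    using suminf_scaleR_right[of "\<lambda>n. nrm n (z n) *\<^sub>R e n" D, symmetric] z D
    by (simp add: mem_Z_iff sum_norm_def)
  then show "Znorm w \<le> D * Znorm z"
    using unconditional_suminf_mono[OF *] by (simp add: sum_norm_def)
qed

lemma norm_coord_le:
  assumes "z \<in> Z"
  shows "nrm n (z n) \<le> Znorm z"
  using unconditional_sum_le_suminf[OF unconditional_e, of "\<lambda>n. nrm n (z n)" "{n}" "\<lambda>n. nrm n (z n)"]
    assms comp.norm_nonneg[OF coord_mem[OF assms]] by (simp add: mem_Z_iff norm_e sum_norm_def)

lemma Z_add: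
  assumes x: "x \<in> Z" and y: "y \<in> Z"
  shows "x + y \<in> Z" "Znorm (x + y) \<le> Znorm x + Znorm y"
proof -
  have s: "summable (\<lambda>n. nrm n (x n) *\<^sub>R e n + nrm n (y n) *\<^sub>R e n)"
    using x y by (intro summable_add) (auto simp: mem_Z_iff)
  then have s': "summable (\<lambda>n. (nrm n (x n) + nrm n (y n)) *\<^sub>R e n)"
    by (simp add: scaleR_add_left)
  have "0 \<le> nrm n (x n + y n)" "nrm n (x n + y n) \<le> nrm n (x n) + nrm n (y n)" for n
    using coord_mem[OF x, of n] coord_mem[OF y, of n]
    by (auto intro: comp.norm_nonneg comp.norm_triangle comp.add_mem)
  then have "\<bar>nrm n ((x + y) n)\<bar> \<le> \<bar>nrm n (x n) + nrm n (y n)\<bar>" for n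
    by (simp add: abs_le_iff order_trans[of _ "nrm n (x n + y n)"])
  note * = unconditional_e s' this
  show "x + y \<in> Z"
    using unconditional_summable[OF *] x y by (auto simp: mem_Z_iff comp.add_mem)
  have "Znorm (x + y) \<le> norm (\<Sum>n. (nrm n (x n) + nrm n (y n)) *\<^sub>R e n)"
    using unconditional_suminf_mono[OF *] by (simp add: sum_norm_def)
  also have "\<dots> = norm ((\<Sum>n. nrm n (x n) *\<^sub>R e n) + (\<Sum>n. nrm n (y n) *\<^sub>R e n))"
    using x y by (simp add: scaleR_add_left suminf_add mem_Z_iff)
  also have "\<dots> \<le> Znorm x + Znorm y"
    unfolding sum_norm_def by (rule norm_triangle_ineq)
  finally show "Znorm (x + y) \<le> Znorm x + Znorm y" .
qed

lemma Z_scaleR: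
  assumes z: "z \<in> Z"
  shows "c *\<^sub>R z \<in> Z" "Znorm (c *\<^sub>R z) = \<bar>c\<bar> * Znorm z"
proof -
  have eq: "nrm n ((c *\<^sub>R z) n) *\<^sub>R e n = \<bar>c\<bar> *\<^sub>R (nrm n (z n) *\<^sub>R e n)" for n
    using comp.norm_scaleR[OF coord_mem[OF z]] by simp
  have s: "summable (\<lambda>n. nrm n (z n) *\<^sub>R e n)" using z by (simp add: mem_Z_iff)
  then show "c *\<^sub>R z \<in> Z"
    unfolding mem_Z_iff eq
    using z summable_scaleR_right[OF s, of "\<bar>c\<bar>"] by (auto simp: comp.scaleR_mem coord_mem)
  show "Znorm (c *\<^sub>R z) = \<bar>c\<bar> * Znorm z"
    unfolding sum_norm_def eq using suminf_scaleR_right[OF s, of "\<bar>c\<bar>", symmetric] by simp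
qed

lemma zero_mem_Z: "0 \<in> Z" and Znorm_zero: "Znorm 0 = 0"
  using comp.zero_mem comp.norm_zero by (simp_all add: mem_Z_iff sum_norm_def)

sublocale total: normed_subspace Z Znorm
proof
  show "subspace Z"
    by (intro subspaceI zero_mem_Z Z_add Z_scaleR)
  have "z = 0" if z: "z \<in> Z" "Znorm z = 0" for z
  proof
    fix n
    have "nrm n (z n) = 0"
      using norm_coord_le[OF z(1), of n] z comp.norm_nonneg[OF coord_mem, of z n] by simp
    then show "z n = 0 n" using comp.norm_eq_0_iff coord_mem z by auto
  qed
  then show "norm_on Z Znorm"
    using Z_add Z_scaleR Znorm_nonneg Znorm_zero unfolding norm_on_def by auto
qed

lemma coord_diff: "(x - y) n = x n - y n" for x y :: "nat \<Rightarrow> 'b"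
  by simp

lemma partial_norm_le_Znorm:
  assumes "z \<in> Z" "finite A"
  shows "norm (\<Sum>n\<in>A. nrm n (z n) *\<^sub>R e n) \<le> Znorm z"
  unfolding sum_norm_def using assms
  by (intro unconditional_sum_le_suminf[OF unconditional_e]) (auto simp: mem_Z_iff)

text \<open>The coordinatewise limit of a Cauchy sequence belongs to the direct sum since the estimates on
  finite blocks of coordinates pass to the limit, uniformly in the block. Bounded partial
  sums alone would not suffice, because in \<open>X = c\<^sub>0\<close> they need not converge.\<close>

lemma banach_Z: "banach_on Z Znorm"
  unfolding banach_on_def
proof (intro conjI total.subspace total.norm_on total.mcomplete_norm_iff[THEN iffD2] allI impI)
  fix \<sigma> :: "nat \<Rightarrow> nat \<Rightarrow> 'b"
  assume \<sigma>: "\<forall>k. \<sigma> k \<in> Z"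
    and Cauchy: "\<forall>\<epsilon>>0. \<exists>K. \<forall>k\<ge>K. \<forall>l\<ge>K. Znorm (\<sigma> k - \<sigma> l) < \<epsilon>"
  have \<sigma>Y: "\<sigma> k n \<in> Y n" for k n using \<sigma> coord_mem by blast
  have "\<exists>y\<in>Y n. (\<lambda>k. nrm n (\<sigma> k n - y)) \<longlonglongrightarrow> 0" for n
  proof -
    have "nrm n (\<sigma> k n - \<sigma> l n) \<le> Znorm (\<sigma> k - \<sigma> l)" for k l
      using norm_coord_le[OF total.diff_mem, of "\<sigma> k" "\<sigma> l" n] \<sigma> by simp
    then have "\<forall>\<epsilon>>0. \<exists>K. \<forall>k\<ge>K. \<forall>l\<ge>K. nrm n (\<sigma> k n - \<sigma> l n) < \<epsilon>"
      using Cauchy by (meson le_less_trans)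
    moreover have "comp.mcomplete n" using banach_Y[of n] by (simp add: banach_on_def)
    ultimately show ?thesis
      using \<sigma>Y unfolding comp.mcomplete_norm_iff by (elim allE[of _ "\<lambda>k. \<sigma> k n"]) simp
  qed
  then obtain z where zY: "\<And>n. z n \<in> Y n" and z: "\<And>n. (\<lambda>k. nrm n (\<sigma> k n - z n)) \<longlonglongrightarrow> 0"
    by metis
  \<comment> \<open>the Cauchy estimate on a finite set of coordinates, after passing to the limit in one index\<close>
  have near: "norm (\<Sum>n\<in>A. nrm n (\<sigma> k n - z n) *\<^sub>R e n) \<le> \<epsilon>"
    if K: "\<forall>k\<ge>K. \<forall>l\<ge>K. Znorm (\<sigma> k - \<sigma> l) < \<epsilon>" and "k \<ge> K" "finite A" for \<epsilon> K k A
  proof (rule Lim_bounded[of _ _ K])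
    have "(\<lambda>l. nrm n (\<sigma> k n - \<sigma> l n)) \<longlonglongrightarrow> nrm n (\<sigma> k n - z n)" for n
    proof (rule LIMSEQ_I)
      fix r :: real assume "r > 0"
      then obtain l0 where l0: "nrm n (\<sigma> l n - z n) < r" if "l \<ge> l0" for l
        using LIMSEQ_D[OF z, of r n] by fastforce
      have "\<bar>nrm n (\<sigma> k n - \<sigma> l n) - nrm n (\<sigma> k n - z n)\<bar> \<le> nrm n (\<sigma> l n - z n)" for l
        using comp.norm_diff_abs_le[of "\<sigma> k n - \<sigma> l n" n "\<sigma> k n - z n"]
          comp.norm_minus_commute[of "\<sigma> l n" n "z n"]
        by (simp add: comp.diff_mem \<sigma>Y zY)
      then show "\<exists>l0. \<forall>l\<ge>l0. norm (nrm n (\<sigma> k n - \<sigma> l n) - nrm n (\<sigma> k n - z n)) < r"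
        using l0 by (auto intro!: exI[of _ l0] intro: le_less_trans)
    qed
    then show "(\<lambda>l. norm (\<Sum>n\<in>A. nrm n (\<sigma> k n - \<sigma> l n) *\<^sub>R e n)) \<longlonglongrightarrow>
        norm (\<Sum>n\<in>A. nrm n (\<sigma> k n - z n) *\<^sub>R e n)"
      by (intro tendsto_intros)
    show "\<forall>l\<ge>K. norm (\<Sum>n\<in>A. nrm n (\<sigma> k n - \<sigma> l n) *\<^sub>R e n) \<le> \<epsilon>"
    proof (intro allI impI)
      fix l assume "l \<ge> K"
      then show "norm (\<Sum>n\<in>A. nrm n (\<sigma> k n - \<sigma> l n) *\<^sub>R e n) \<le> \<epsilon>"
        using partial_norm_le_Znorm[OF total.diff_mem, of "\<sigma> k" "\<sigma> l" A] \<sigma> that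
        by (force intro: order_trans less_imp_le)
    qed
  qed
  have "summable (\<lambda>n. nrm n (z n) *\<^sub>R e n)"
    unfolding summable_Cauchy
  proof (intro allI impI)
    fix r :: real assume r: "r > 0"
    then obtain K where K: "\<forall>k\<ge>K. \<forall>l\<ge>K. Znorm (\<sigma> k - \<sigma> l) < r / 2"
      using Cauchy half_gt_zero by blast
    have "summable (\<lambda>n. nrm n (\<sigma> K n) *\<^sub>R e n)" using \<sigma> mem_Z_iff by blast
    then obtain M where M: "\<And>m n. m \<ge> M \<Longrightarrow> norm (\<Sum>i\<in>{m..<n}. nrm i (\<sigma> K i) *\<^sub>R e i) < r / 2"
      using r unfolding summable_Cauchy by (meson half_gt_zero)
    have "norm (\<Sum>i\<in>{m..<n}. nrm i (z i) *\<^sub>R e i) < r" if "m \<ge> M" for m n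
    proof -
      have le: "nrm i (z i) \<le> nrm i (\<sigma> K i) + nrm i (\<sigma> K i - z i)" for i
        using comp.norm_triangle_diff[of "\<sigma> K i" i "\<sigma> K i - z i"]
        by (simp add: comp.diff_mem \<sigma>Y zY)
      have "norm (\<Sum>i\<in>{m..<n}. nrm i (z i) *\<^sub>R e i)
          \<le> norm (\<Sum>i\<in>{m..<n}. (nrm i (\<sigma> K i) + nrm i (\<sigma> K i - z i)) *\<^sub>R e i)"
        using le comp.norm_nonneg[OF zY]
        by (intro unconditional_mono[OF unconditional_e]) (auto intro: order_trans[OF _ abs_ge_self])
      also have "\<dots> \<le> norm (\<Sum>i\<in>{m..<n}. nrm i (\<sigma> K i) *\<^sub>R e i)
          + norm (\<Sum>i\<in>{m..<n}. nrm i (\<sigma> K i - z i) *\<^sub>R e i)"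
        by (simp add: scaleR_add_left sum.distrib norm_triangle_ineq)
      also have "\<dots> < r / 2 + r / 2"
        using M[OF that] near[OF K, of K "{m..<n}"] by (intro add_less_le_mono) auto
      finally show ?thesis by simp
    qed
    then show "\<exists>N. \<forall>m\<ge>N. \<forall>n. norm (\<Sum>i\<in>{m..<n}. nrm i (z i) *\<^sub>R e i) < r" by blast
  qed
  then have zZ: "z \<in> Z" using zY by (simp add: mem_Z_iff)
  have "(\<lambda>k. Znorm (\<sigma> k - z)) \<longlonglongrightarrow> 0"
  proof (rule LIMSEQ_I)
    fix r :: real assume r: "r > 0"
    then obtain K where K: "\<forall>k\<ge>K. \<forall>l\<ge>K. Znorm (\<sigma> k - \<sigma> l) < r / 2"
      using Cauchy half_gt_zero by blast
    have "Znorm (\<sigma> k - z) \<le> r / 2" if "k \<ge> K" for k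
      unfolding sum_norm_def coord_diff
    proof (rule norm_suminf_le)
      show "summable (\<lambda>n. nrm n (\<sigma> k n - z n) *\<^sub>R e n)"
        using total.diff_mem[of "\<sigma> k" z] zZ \<sigma> by (simp add: mem_Z_iff)
    qed (use near[OF K that] in simp)
    then show "\<exists>K. \<forall>k\<ge>K. norm (Znorm (\<sigma> k - z) - 0) < r"
      using r Znorm_nonneg by (intro exI[of _ K]) (force intro: le_less_trans)
  qed
  then show "\<exists>z\<in>Z. (\<lambda>k. Znorm (\<sigma> k - z)) \<longlonglongrightarrow> 0" using zZ by blast
qed

lemma coord_embed_apply [simp]: "coord_embed k y n = (if n = k then y else 0)"
  by (simp add: coord_embed_def)

lemma linear_coord_embed: "linear (coord_embed k)"
  by (auto simp: linear_iff fun_eq_iff)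

lemma coord_embed_isometry:
  assumes "y \<in> Y k"
  shows "coord_embed k y \<in> Z" "Znorm (coord_embed k y) = nrm k y"
proof -
  have eq: "nrm n (coord_embed k y n) *\<^sub>R e n = (if n = k then nrm k y *\<^sub>R e k else 0)" for n
    using comp.norm_zero by simp
  show "coord_embed k y \<in> Z"
    unfolding mem_Z_iff eq using assms comp.zero_mem by simp
  show "Znorm (coord_embed k y) = nrm k y"
    unfolding sum_norm_def eq using comp.norm_nonneg[OF assms]
    by (subst suminf_finite[of "{k}"]) (auto simp: norm_e)
qed

end

section \<open>The interlaced basis\<close>

locale direct_sum_basis = direct_sum e Y nrm
  for e :: "nat \<Rightarrow> 'x::banach" and Y :: "nat \<Rightarrow> 'b::real_vector set" and nrm +
  fixes b :: "nat \<Rightarrow> nat \<Rightarrow> 'b" and lambda :: real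
    and idx :: "nat \<Rightarrow> nat \<times> nat" and et :: "nat \<Rightarrow> nat \<Rightarrow> 'b"
  assumes schauder_Y: "\<And>n. schauder_basis (Y n) (nrm n) (b n)"
    and normalized_Y: "\<And>n. normalized (nrm n) (b n)"
    and basis_constant_Y: "\<And>n. basis_constant (Y n) (nrm n) (b n) \<le> ereal lambda"
    and lambda_ge_1: "1 \<le> lambda"
    and bij_idx: "bij idx"
    and et_idx: "\<And>m n i. idx m = (n, i) \<Longrightarrow> et m = coord_embed n (b n i)"
    and order_idx: "\<And>n i j. i < j \<Longrightarrow> inv idx (n, i) < inv idx (n, j)"
begin

sublocale comp: schauder_space "Y n" "nrm n" "b n" lambda for n
  by unfold_locales (rule schauder_Y normalized_Y basis_constant_Y)+

definition pos :: "nat \<Rightarrow> nat \<Rightarrow> nat"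
  where "pos n i = inv idx (n, i)"

lemma idx_pos [simp]: "idx (pos n i) = (n, i)"
  unfolding pos_def using bij_idx by (simp add: bij_is_surj surj_f_inv_f)

lemma pos_idx: "idx m = (n, i) \<Longrightarrow> pos n i = m"
  unfolding pos_def using bij_idx by (metis bij_is_inj inv_f_f)

lemma pos_fst_snd [simp]: "pos (fst (idx m)) (snd (idx m)) = m"
  by (rule pos_idx) simp

lemma pos_exhaust:
  obtains n i where "m = pos n i"
  by (metis pos_fst_snd)

lemma strict_mono_pos: "strict_mono (pos n)"
  by (intro strict_monoI) (simp add: pos_def order_idx)

lemma inj_pos: "inj (pos n)"
  by (rule strict_mono_imp_inj_on[OF strict_mono_pos])

text \<open>The number of basis vectors of the \<open>n\<close>-th summand among the first \<open>m\<close> vectors of the enumeration. It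
  is defined as a least index because these vectors form an initial segment, which is what
  \<open>pos_less_iff\<close> states.\<close>

definition count :: "nat \<Rightarrow> nat \<Rightarrow> nat"
  where "count n m = (LEAST i. m \<le> pos n i)"

lemma pos_less_iff: "pos n i < m \<longleftrightarrow> i < count n m"
proof -
  have "m \<le> pos n m" by (rule strict_mono_imp_increasing[OF strict_mono_pos])
  then have *: "m \<le> pos n (count n m)" unfolding count_def by (rule LeastI)
  show ?thesis
  proof
    show "i < count n m" if "pos n i < m"
      using order_less_le_trans[OF that *] strict_mono_less[OF strict_mono_pos] by blast
    show "pos n i < m" if "i < count n m"
      using not_less_Least[of i "\<lambda>i. m \<le> pos n i"] that by (simp add: count_def)
  qed
qed

lemma count_pos [simp]: "count n (pos n k) = k"
proof -
  have "i < count n (pos n k) \<longleftrightarrow> i < k" for i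
    using pos_less_iff[of n i "pos n k"] strict_mono_less[OF strict_mono_pos] by simp
  then show ?thesis by (metis linorder_neqE_nat less_irrefl)
qed

lemma filterlim_count: "filterlim (count n) at_top sequentially"
  unfolding filterlim_at_top eventually_sequentially
proof (intro allI exI impI)
  fix k m assume "pos n k \<le> m"
  then have "i < count n m" if "i < k" for i
    using that strict_mono_less[OF strict_mono_pos, of n i k] by (simp flip: pos_less_iff)
  then show "k \<le> count n m" by (meson less_irrefl not_less)
qed

lemma sum_over_component:
  assumes "finite K"
  shows "(\<Sum>m\<in>K. if n = fst (idx m) then g m else 0) = (\<Sum>i | pos n i \<in> K. g (pos n i))"
proof -
  have "(\<Sum>m\<in>K. if n = fst (idx m) then g m else 0) = (\<Sum>m\<in>{m \<in> K. n = fst (idx m)}. g m)"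
    using assms by (intro sum.inter_filter[symmetric])
  also have "\<dots> = (\<Sum>i | pos n i \<in> K. g (pos n i))"
    by (rule sum.reindex_bij_witness[of _ "pos n" "\<lambda>m. snd (idx m)"]) auto
  finally show ?thesis .
qed

lemma coord_sum_embed:
  assumes "finite K"
  shows "(\<Sum>m\<in>K. coord_embed (fst (idx m)) (g m)) n = (\<Sum>i | pos n i \<in> K. g (pos n i))"
  using sum_over_component[OF assms] by simp

lemma coord_embed_scaleR: "c *\<^sub>R coord_embed k y = coord_embed k (c *\<^sub>R y)"
  by (simp add: fun_eq_iff)

lemma et_eq: "et m = coord_embed (fst (idx m)) (b (fst (idx m)) (snd (idx m)))"
  by (rule et_idx) simp

lemma et_pos: "et (pos n i) = coord_embed n (b n i)"
  by (simp add: et_eq)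

text \<open>The link between the enumeration and the summands: a partial sum in the direct sum is a partial
  sum in each coordinate, although of different lengths.\<close>

lemma coord_partial_sum: "(\<Sum>m<M. a m *\<^sub>R et m) n = (\<Sum>i<count n M. a (pos n i) *\<^sub>R b n i)"
proof -
  have "(\<Sum>m<M. a m *\<^sub>R et m) n = (\<Sum>i | pos n i \<in> {..<M}. a (pos n i) *\<^sub>R b n i)"
    unfolding et_eq coord_embed_scaleR by (subst coord_sum_embed) simp_all
  then show ?thesis by (simp add: pos_less_iff lessThan_def)
qed

lemma et_mem: "et m \<in> Z"
  by (simp add: et_eq coord_embed_isometry comp.basis_mem)

lemma Znorm_et: "Znorm (et m) = 1"
  by (simp add: et_eq coord_embed_isometry comp.basis_mem comp.norm_basis)

definition coeff :: "nat \<Rightarrow> (nat \<Rightarrow> 'b) \<Rightarrow> real"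
  where "coeff m z = (case idx m of (n, i) \<Rightarrow> biorth (Y n) (nrm n) (b n) i (z n))"

lemma coeff_pos: "coeff (pos n i) z = biorth (Y n) (nrm n) (b n) i (z n)"
  by (simp add: coeff_def)

lemma coord_partial_sum_coeff:
  "(\<Sum>m<M. coeff m z *\<^sub>R et m) n = comp.partial_sum n (count n M) (z n)"
  by (simp only: coord_partial_sum coeff_pos comp.partial_sum_def)

lemma norm_partial_sum_coeff_le:
  assumes z: "z \<in> Z"
  shows "Znorm (\<Sum>m<M. coeff m z *\<^sub>R et m) \<le> lambda * Znorm z"
  using lambda_ge_1 comp.norm_partial_sum_le[OF coord_mem[OF z]]
  by (intro Z_dominated(2)[OF z])
    (auto simp only: coord_partial_sum_coeff comp.partial_sum_mem)

lemma basis_expansion_coeff: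
  assumes z: "z \<in> Z"
  shows "basis_expansion Znorm et z (\<lambda>m. coeff m z)"
  unfolding basis_expansion_def sum_norm_def coord_diff coord_partial_sum_coeff
proof (rule unconditional_dominated_convergence[OF unconditional_e])
  show "summable (\<lambda>n. ((1 + lambda) * nrm n (z n)) *\<^sub>R e n)"
    using z summable_scaleR_right[of "\<lambda>n. nrm n (z n) *\<^sub>R e n" "1 + lambda"] by (simp add: mem_Z_iff)
  fix M n
  have "nrm n (z n - comp.partial_sum n (count n M) (z n))
      \<le> nrm n (z n) + nrm n (comp.partial_sum n (count n M) (z n))"
    by (intro comp.norm_triangle_diff coord_mem z comp.partial_sum_mem)
  also have "\<dots> \<le> nrm n (z n) + lambda * nrm n (z n)"
    by (intro add_left_mono comp.norm_partial_sum_le coord_mem z)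
  finally have "nrm n (z n - comp.partial_sum n (count n M) (z n)) \<le> (1 + lambda) * nrm n (z n)"
    by (simp add: distrib_right)
  moreover have "0 \<le> nrm n (z n - comp.partial_sum n (count n M) (z n))"
    by (intro comp.norm_nonneg comp.diff_mem comp.partial_sum_mem coord_mem z)
  ultimately show "\<bar>nrm n (z n - comp.partial_sum n (count n M) (z n))\<bar> \<le> \<bar>(1 + lambda) * nrm n (z n)\<bar>"
    by linarith
  show "(\<lambda>M. nrm n (z n - comp.partial_sum n (count n M) (z n))) \<longlonglongrightarrow> 0"
    by (rule filterlim_compose[OF comp.partial_sum_tendsto[OF coord_mem[OF z]] filterlim_count])
qed

text \<open>Projecting to the \<open>n\<close>-th coordinate and passing to the subsequence of places of the vectors from \<open>Y\<^sub>n\<close>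
  turns an expansion of \<open>z\<close> into an expansion of \<open>z n\<close>, whose coefficients are unique.\<close>

lemma expansion_unique:
  assumes z: "z \<in> Z" and a: "basis_expansion Znorm et z a"
  shows "a = (\<lambda>m. coeff m z)"
proof
  fix m
  obtain n i where m: "idx m = (n, i)" by force
  have "basis_expansion (nrm n) (b n) (z n) (\<lambda>i. a (pos n i))"
    unfolding basis_expansion_def
  proof (rule tendsto_sandwich[OF _ _ tendsto_const])
    let ?S = "\<lambda>k. z - (\<Sum>m<pos n k. a m *\<^sub>R et m)"
    have S: "?S k n = z n - (\<Sum>i<k. a (pos n i) *\<^sub>R b n i)" for k
      by (simp only: coord_diff coord_partial_sum count_pos)
    have SZ: "?S k \<in> Z" for k
      by (intro total.diff_mem z total.sum_mem total.scaleR_mem et_mem)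
    show "\<forall>\<^sub>F k in sequentially. 0 \<le> nrm n (z n - (\<Sum>i<k. a (pos n i) *\<^sub>R b n i))"
      by (intro always_eventually allI comp.norm_nonneg comp.diff_mem coord_mem z comp.sum_mem
          comp.scaleR_mem comp.basis_mem)
    show "\<forall>\<^sub>F k in sequentially. nrm n (z n - (\<Sum>i<k. a (pos n i) *\<^sub>R b n i)) \<le> Znorm (?S k)"
      using norm_coord_le[OF SZ, of n] by (intro always_eventually allI) (simp only: S)
    show "(\<lambda>k. Znorm (?S k)) \<longlonglongrightarrow> 0"
      using a filterlim_subseq[OF strict_mono_pos] unfolding basis_expansion_def
      by (rule filterlim_compose)
  qed
  then have "biorth (Y n) (nrm n) (b n) i (z n) = a (pos n i)"
    by (rule comp.biorth_eqI[OF coord_mem[OF z]])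
  then show "a m = coeff m z"
    using m pos_idx[OF m] by (simp add: coeff_def)
qed

lemma schauder_basis_et: "schauder_basis Z Znorm et"
  unfolding schauder_basis_def using et_mem basis_expansion_coeff expansion_unique by blast

lemma biorth_et: "biorth Z Znorm et m z = (if z \<in> Z then coeff m z else 0)"
proof (cases "z \<in> Z")
  case True
  have "(THE a. basis_expansion Znorm et z a) = (\<lambda>m. coeff m z)"
    using True by (intro the_equality basis_expansion_coeff expansion_unique)
  then show ?thesis using True by (simp add: biorth_def)
qed (simp add: biorth_def)

lemma basis_constant_et: "basis_constant Z Znorm et \<le> ereal lambda"
  unfolding basis_constant_def
proof (intro SUP_least, clarify)
  fix M z assume z: "z \<in> Z" "Znorm z \<le> 1"
  have "Znorm (\<Sum>m<M. coeff m z *\<^sub>R et m) \<le> lambda * Znorm z"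
    by (rule norm_partial_sum_coeff_le[OF z(1)])
  also have "\<dots> \<le> lambda" using z lambda_ge_1 by (simp add: mult_left_le)
  finally show "ereal (Znorm (\<Sum>m<M. biorth Z Znorm et m z *\<^sub>R et m)) \<le> ereal lambda"
    using z by (simp add: biorth_et)
qed

sublocale total: schauder_space Z Znorm et lambda
  by unfold_locales
    (simp_all add: schauder_basis_et basis_constant_et normalized_def Znorm_et)

end

section \<open>Pulling back subspaces of finite codimension\<close>

text \<open>The elements of \<open>F\<close> are removed one by one. Adding a single vector \<open>x\<close> to \<open>W\<close> enlarges the preimage of
  \<open>W\<close> by at most one dimension: any \<open>y\<^sub>0\<close> that is mapped into the larger space but not into \<open>W\<close>
  spans the larger preimage together with that of \<open>W\<close>, since subtracting a suitable multiple of it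
  cancels the \<open>x\<close>-component of an image.\<close>

lemma finite_codim_pullback_aux:
  assumes lin: "linear T" and U: "subspace U"
    and "finite F" "subspace W" "\<And>y. y \<in> U \<Longrightarrow> T y \<in> span (W \<union> F)"
  shows "\<exists>F'. finite F' \<and> F' \<subseteq> U \<and> U \<subseteq> span ({y \<in> U. T y \<in> W} \<union> F')"
  using assms(3-)
proof (induction F arbitrary: W)
  case empty
  have "span W = W" using empty.prems(1) by (simp only: span_eq_iff)
  then have "T y \<in> W" if "y \<in> U" for y using empty.prems(2)[OF that] by (simp only: Un_empty_right)
  then have "{y \<in> U. T y \<in> W} = U" by auto
  then show ?case by (intro exI[of _ "{}"]) (auto intro: span_base)
next
  case (insert x F)
  let ?W = "span (insert x W)"
  have W: "span W = W" using insert.prems(1) by (simp only: span_eq_iff)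
  have "W \<union> insert x F \<subseteq> span (?W \<union> F)"
    by (auto intro!: span_base)
  then have "span (W \<union> insert x F) \<subseteq> span (?W \<union> F)"
    by (rule span_minimal) simp
  then obtain F1 where F1: "finite F1" "F1 \<subseteq> U" "U \<subseteq> span ({y \<in> U. T y \<in> ?W} \<union> F1)"
    using insert.IH[of ?W] insert.prems by blast
  show ?case
  proof (cases "\<exists>y\<in>U. T y \<in> ?W - W")
    case False
    then have "{y \<in> U. T y \<in> ?W} = {y \<in> U. T y \<in> W}" by (auto intro: span_base)
    then show ?thesis using F1 by auto
  next
    case True
    then obtain y0 where y0: "y0 \<in> U" "T y0 \<in> ?W" "T y0 \<notin> W" by blast
    obtain c where c: "T y0 - c *\<^sub>R x \<in> W"
      using y0(2) unfolding span_breakdown_eq W by blast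
    have c0: "c \<noteq> 0" using c y0(3) by auto
    let ?S = "{y \<in> U. T y \<in> W} \<union> insert y0 F1"
    have "y \<in> span ?S" if y: "y \<in> U" "T y \<in> ?W" for y
    proof -
      obtain d where d: "T y - d *\<^sub>R x \<in> W"
        using y(2) unfolding span_breakdown_eq W by blast
      have "T (y - (d / c) *\<^sub>R y0) = (T y - d *\<^sub>R x) - (d / c) *\<^sub>R (T y0 - c *\<^sub>R x)"
        using c0 by (simp add: linear_diff[OF lin] linear_scale[OF lin] scaleR_right_diff_distrib)
      then have "T (y - (d / c) *\<^sub>R y0) \<in> W"
        using c d insert.prems(1) by (simp add: subspace_diff subspace_scale)
      moreover have "y - (d / c) *\<^sub>R y0 \<in> U"
        using y y0 U by (simp add: subspace_diff subspace_scale)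
      ultimately have "(y - (d / c) *\<^sub>R y0) + (d / c) *\<^sub>R y0 \<in> span ?S"
        by (intro span_add span_scale span_base) auto
      then show ?thesis by simp
    qed
    then have "{y \<in> U. T y \<in> ?W} \<union> F1 \<subseteq> span ?S" by (auto intro: span_base)
    then have "span ({y \<in> U. T y \<in> ?W} \<union> F1) \<subseteq> span ?S"
      by (rule span_minimal) simp
    then show ?thesis
      using F1 y0(1) by (intro exI[of _ "insert y0 F1"]) auto
  qed
qed

lemma finite_codim_pullback:
  assumes lin: "linear T" and U: "subspace U" and T: "\<And>y. y \<in> U \<Longrightarrow> T y \<in> V"
    and W: "finite_codim V W"
  shows "finite_codim U {y \<in> U. T y \<in> W}"
proof -
  obtain F where F: "finite F" "V = span (W \<union> F)" and sub: "subspace W"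
    using W by (auto simp: finite_codim_def)
  obtain F' where F': "finite F'" "F' \<subseteq> U" "U \<subseteq> span ({y \<in> U. T y \<in> W} \<union> F')"
    using finite_codim_pullback_aux[OF lin U F(1) sub] T F(2) by blast
  have "{y \<in> U. T y \<in> W} = U \<inter> T -` W" by auto
  then have "subspace {y \<in> U. T y \<in> W}"
    using U sub lin by (simp add: subspace_inter linear_subspace_vimage)
  moreover have "span ({y \<in> U. T y \<in> W} \<union> F') \<subseteq> U"
    using F'(2) U by (intro span_minimal) auto
  ultimately show ?thesis using F' by (auto simp: finite_codim_def)
qed

section \<open>Functionals on a summand as functionals on the direct sum\<close>

context direct_sum
begin

text \<open>The functional \<open>f \<circ> P\<^sub>n\<close>, extended by \<open>0\<close> outside the direct sum as membership in \<^const>\<open>dual\<close> demands.\<close>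

definition functional_embed :: "nat \<Rightarrow> ('b \<Rightarrow> real) \<Rightarrow> (nat \<Rightarrow> 'b) \<Rightarrow> real"
  where "functional_embed n f z = (if z \<in> Z then f (z n) else 0)"

lemma linear_functional_embed: "linear (functional_embed n)"
  by (auto simp: linear_iff fun_eq_iff functional_embed_def)

lemma functional_embed_mem_dual:
  assumes f: "f \<in> dual (Y n) (nrm n)"
  shows "functional_embed n f \<in> dual Z Znorm"
proof -
  have "\<bar>f (z n)\<bar> \<le> dual_norm (Y n) (nrm n) f * Znorm z" if "z \<in> Z" for z
    using comp.abs_le_dual_norm[OF f coord_mem[OF that]]
      mult_left_mono[OF norm_coord_le[OF that, of n] comp.dual_norm_nonneg[OF f]] by linarith
  then have "\<exists>B. \<forall>z\<in>Z. \<bar>functional_embed n f z\<bar> \<le> B * Znorm z"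
    by (auto simp: functional_embed_def)
  then show ?thesis
    using f coord_mem total.add_mem total.scaleR_mem
    by (simp add: dual_def functional_embed_def)
qed

lemma dual_norm_functional_embed_le:
  assumes f: "f \<in> dual (Y n) (nrm n)"
  shows "dual_norm Z Znorm (functional_embed n f) \<le> dual_norm (Y n) (nrm n) f"
proof (rule total.dual_norm_le)
  fix z assume "z \<in> Z" "Znorm z \<le> 1"
  then show "\<bar>functional_embed n f z\<bar> \<le> dual_norm (Y n) (nrm n) f"
    using norm_coord_le[of z n] by (simp add: functional_embed_def comp.abs_le_dual_norm_unit[OF f] coord_mem)
qed

lemma cof_pullback:
  assumes "W \<in> cof Z Znorm"
  shows "{y \<in> Y n. coord_embed n y \<in> W} \<in> cof (Y n) (nrm n)"
proof -
  have W: "finite_codim Z W" and "closedin total.mtopology W"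
    using assms by (simp_all add: cof_def)
  then have closed: "\<And>\<sigma> l. l \<in> Z \<Longrightarrow> \<forall>k. \<sigma> k \<in> W \<Longrightarrow> (\<lambda>k. Znorm (\<sigma> k - l)) \<longlonglongrightarrow> 0 \<Longrightarrow> l \<in> W"
    by (simp only: total.closedin_norm_iff)
  have "closedin (comp.mtopology n) {y \<in> Y n. coord_embed n y \<in> W}"
    unfolding comp.closedin_norm_iff
  proof (intro conjI allI ballI impI)
    fix \<sigma> l assume l: "l \<in> Y n" and \<sigma>: "\<forall>k. \<sigma> k \<in> {y \<in> Y n. coord_embed n y \<in> W}"
      and lim: "(\<lambda>k. nrm n (\<sigma> k - l)) \<longlonglongrightarrow> 0"
    have "Znorm (coord_embed n (\<sigma> k) - coord_embed n l) = nrm n (\<sigma> k - l)" for k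
      using coord_embed_isometry(2)[OF comp.diff_mem, of "\<sigma> k" n l] \<sigma> l
      by (simp add: linear_diff[OF linear_coord_embed])
    then have "coord_embed n l \<in> W"
      using \<sigma> lim coord_embed_isometry(1)[OF l] by (intro closed[of _ "\<lambda>k. coord_embed n (\<sigma> k)"]) auto
    then show "l \<in> {y \<in> Y n. coord_embed n y \<in> W}" using l by simp
  qed (rule Collect_restrict)
  moreover have "finite_codim (Y n) {y \<in> Y n. coord_embed n y \<in> W}"
  proof (rule finite_codim_pullback[where V = Z])
    show "coord_embed n y \<in> Z" if "y \<in> Y n" for y
      by (rule coord_embed_isometry(1)[OF that])
  qed (rule linear_coord_embed comp.subspace W)+
  ultimately show ?thesis by (simp add: cof_def)
qed

text \<open>For the weak-* topologies the embedding is continuous because each of its values is either constantly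
  \<open>0\<close> or the evaluation at one coordinate.\<close>

lemma cof_wstar_pullback:
  assumes "G \<in> cof_wstar Z Znorm"
  shows "{f \<in> dual (Y n) (nrm n). functional_embed n f \<in> G} \<in> cof_wstar (Y n) (nrm n)"
proof -
  have G: "finite_codim (dual Z Znorm) G" "closedin (top_of_set (dual Z Znorm)) G"
    using assms by (auto simp: cof_wstar_def)
  have "continuous_on UNIV (functional_embed n)"
  proof (rule continuous_on_coordinatewise_then_product)
    fix z show "continuous_on UNIV (\<lambda>f. functional_embed n f z)"
      by (cases "z \<in> Z") (simp_all add: functional_embed_def)
  qed
  then have "continuous_map (top_of_set (dual (Y n) (nrm n))) (top_of_set (dual Z Znorm)) (functional_embed n)"
    by (auto simp: continuous_map_in_subtopology functional_embed_mem_dual intro: continuous_on_subset)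
  from closedin_continuous_map_preimage[OF this G(2)]
  have "closedin (top_of_set (dual (Y n) (nrm n))) {f \<in> dual (Y n) (nrm n). functional_embed n f \<in> G}"
    by simp
  moreover have "finite_codim (dual (Y n) (nrm n)) {f \<in> dual (Y n) (nrm n). functional_embed n f \<in> G}"
    by (rule finite_codim_pullback[OF linear_functional_embed comp.dual_subspace
        functional_embed_mem_dual G(1)])
  ultimately show ?thesis by (simp add: cof_wstar_def)
qed

text \<open>The norm of \<open>\<Sum> g\<^sub>n \<circ> P\<^sub>n\<close> is the supremum of \<open>\<Sum> \<parallel>g\<^sub>n\<parallel> \<parallel>z\<^sub>n\<parallel>\<close> over the unit ball of the direct sum: replacing
  \<open>z\<^sub>n\<close> by a vector of no larger norm on which \<open>g\<^sub>n\<close> is at least \<open>t \<parallel>g\<^sub>n\<parallel> \<parallel>z\<^sub>n\<parallel>\<close>, for \<open>t < 1\<close>, does not leave the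
  ball.\<close>

lemma dual_norm_sum_mono:
  assumes A: "finite A" and f: "\<And>n. f n \<in> dual (Y n) (nrm n)" and g: "\<And>n. g n \<in> dual (Y n) (nrm n)"
    and le: "\<And>n. dual_norm (Y n) (nrm n) (f n) \<le> D * dual_norm (Y n) (nrm n) (g n)" and D: "0 \<le> D"
  shows "dual_norm Z Znorm (\<Sum>n\<in>A. functional_embed n (f n))
    \<le> D * dual_norm Z Znorm (\<Sum>n\<in>A. functional_embed n (g n))"
proof (rule total.dual_norm_le)
  let ?G = "\<Sum>n\<in>A. functional_embed n (g n)"
  let ?dn = "\<lambda>n. dual_norm (Y n) (nrm n)"
  fix z assume z: "z \<in> Z" "Znorm z \<le> 1"
  have G: "?G \<in> dual Z Znorm"
    by (intro subspace_sum total.dual_subspace functional_embed_mem_dual g)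
  have "t * (\<Sum>n\<in>A. ?dn n (g n) * nrm n (z n)) \<le> dual_norm Z Znorm ?G" if t: "0 < t" "t < 1" for t
  proof -
    have "\<exists>u\<in>Y n. nrm n u \<le> 1 \<and> t * ?dn n (g n) \<le> g n u" for n
    proof (cases "?dn n (g n) = 0")
      case True
      then show ?thesis
        using comp.abs_le_dual_norm[OF g comp.zero_mem, of n] comp.zero_mem comp.norm_zero
        by (intro bexI[of _ 0]) auto
    next
      case False
      then have "t * ?dn n (g n) < ?dn n (g n)"
        using t comp.dual_norm_nonneg[OF g, of n] by simp
      then show ?thesis
        using comp.dual_norm_nearly_attained[OF g] by (metis less_imp_le)
    qed
    then obtain u where u: "\<And>n. u n \<in> Y n" "\<And>n. nrm n (u n) \<le> 1"
        "\<And>n. t * ?dn n (g n) \<le> g n (u n)" by metis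
    define w where "w n = nrm n (z n) *\<^sub>R u n" for n
    have nz: "0 \<le> nrm n (z n)" for n using comp.norm_nonneg[OF coord_mem[OF z(1)]] .
    have "nrm n (w n) \<le> 1 * nrm n (z n)" for n
      using nz[of n] u by (simp add: w_def comp.norm_scaleR mult_left_le)
    moreover have "w n \<in> Y n" for n by (simp add: w_def comp.scaleR_mem u)
    ultimately have w: "w \<in> Z" "Znorm w \<le> 1"
      using Z_dominated[OF z(1), of w 1] z(2) by auto
    have gw: "g n (w n) = nrm n (z n) * g n (u n)" for n
      using g[of n] u(1)[of n] unfolding w_def dual_def by blast
    have "t * (\<Sum>n\<in>A. ?dn n (g n) * nrm n (z n)) = (\<Sum>n\<in>A. nrm n (z n) * (t * ?dn n (g n)))"
      by (simp add: sum_distrib_left ac_simps)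
    also have "\<dots> \<le> (\<Sum>n\<in>A. nrm n (z n) * g n (u n))"
      by (intro sum_mono mult_left_mono u nz)
    also have "\<dots> = ?G w"
      using w(1) by (simp add: functional_embed_def gw)
    also have "\<dots> \<le> dual_norm Z Znorm ?G"
      using total.abs_le_dual_norm_unit[OF G w] by linarith
    finally show ?thesis .
  qed
  then have *: "(\<Sum>n\<in>A. ?dn n (g n) * nrm n (z n)) \<le> dual_norm Z Znorm ?G"
    by (rule field_le_mult_one_interval)
  have "\<bar>(\<Sum>n\<in>A. functional_embed n (f n)) z\<bar> \<le> (\<Sum>n\<in>A. \<bar>f n (z n)\<bar>)"
    using z(1) by (simp add: functional_embed_def sum_abs)
  also have "\<dots> \<le> (\<Sum>n\<in>A. D * ?dn n (g n) * nrm n (z n))"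
    using comp.abs_le_dual_norm[OF f coord_mem[OF z(1)]] le comp.norm_nonneg[OF coord_mem[OF z(1)]]
    by (intro sum_mono) (meson mult_right_mono order_trans)
  also have "\<dots> = D * (\<Sum>n\<in>A. ?dn n (g n) * nrm n (z n))"
    by (simp add: sum_distrib_left ac_simps)
  also have "\<dots> \<le> D * dual_norm Z Znorm ?G"
    by (intro mult_left_mono * D)
  finally show "\<bar>(\<Sum>n\<in>A. functional_embed n (f n)) z\<bar> \<le> D * dual_norm Z Znorm ?G" .
qed

end

section \<open>Domination of sequences\<close>

text \<open>One half of impartial equivalence. Transferring one half at a time lets the two directions share a
  proof.\<close>

definition dominated ::
    "real \<Rightarrow> ('a::real_vector \<Rightarrow> real) \<Rightarrow> (nat \<Rightarrow> 'a) \<Rightarrow> (nat \<Rightarrow> 'a) \<Rightarrow> bool"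
  where "dominated D nrm x y \<longleftrightarrow> (\<forall>a. finite {i. a i \<noteq> 0} \<longrightarrow>
    nrm (\<Sum>i | a i \<noteq> 0. a i *\<^sub>R x i) \<le> D * nrm (\<Sum>i | a i \<noteq> 0. a i *\<^sub>R y i))"

lemma impartially_equivalent_iff_dominated:
  assumes "0 < C"
  shows "impartially_equivalent C nrm x nrm y \<longleftrightarrow>
    dominated (sqrt C) nrm x y \<and> dominated (sqrt C) nrm y x"
proof -
  have "1 / sqrt C * s \<le> t \<longleftrightarrow> s \<le> sqrt C * t" for s t
    using assms by (simp add: field_simps)
  then show ?thesis unfolding impartially_equivalent_def dominated_def by blast
qed

context direct_sum_basis
begin

definition interlace :: "(nat \<Rightarrow> nat \<Rightarrow> 'c) \<Rightarrow> nat \<Rightarrow> 'c"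
  where "interlace x m = (case idx m of (n, i) \<Rightarrow> x n i)"

lemma interlace_pos [simp]: "interlace x (pos n i) = x n i"
  by (simp add: interlace_def)

lemma interlace_eqI:
  assumes "\<And>n i. y (pos n i) = x n i"
  shows "y = interlace x"
proof
  fix m show "y m = interlace x m" using assms by (cases m rule: pos_exhaust) simp
qed

lemma finite_component_support:
  assumes "finite {m. a m \<noteq> 0}"
  shows "finite {i. a (pos n i) \<noteq> (0::real)}"
  using finite_vimageI[OF assms inj_pos[of n]] by (simp add: vimage_def)

lemma dominated_coord_embed:
  assumes x: "\<And>n i. x n i \<in> Y n" and y: "\<And>n i. y n i \<in> Y n" and D: "0 \<le> D"
    and dom: "\<And>n. dominated D (nrm n) (x n) (y n)"
  shows "dominated D Znorm (interlace (\<lambda>n i. coord_embed n (x n i))) (interlace (\<lambda>n i. coord_embed n (y n i)))"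
  unfolding dominated_def
proof (intro allI impI)
  fix a :: "nat \<Rightarrow> real" assume a: "finite {m. a m \<noteq> 0}"
  have coord: "(\<Sum>m | a m \<noteq> 0. a m *\<^sub>R interlace (\<lambda>n i. coord_embed n (u n i)) m) n
      = (\<Sum>i | a (pos n i) \<noteq> 0. a (pos n i) *\<^sub>R u n i)" for u n
  proof -
    have "(\<Sum>m | a m \<noteq> 0. a m *\<^sub>R interlace (\<lambda>n i. coord_embed n (u n i)) m)
        = (\<Sum>m | a m \<noteq> 0. coord_embed (fst (idx m)) (a m *\<^sub>R interlace u m))"
      by (intro sum.cong) (auto simp: interlace_def fun_eq_iff split: prod.split)
    then show ?thesis by (simp only: coord_sum_embed[OF a] mem_Collect_eq interlace_pos)
  qed
  have mem: "(\<Sum>m | a m \<noteq> 0. a m *\<^sub>R interlace (\<lambda>n i. coord_embed n (y n i)) m) \<in> Z"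
    by (intro total.sum_mem total.scaleR_mem)
      (auto simp: interlace_def y coord_embed_isometry split: prod.split)
  show "Znorm (\<Sum>m | a m \<noteq> 0. a m *\<^sub>R interlace (\<lambda>n i. coord_embed n (x n i)) m)
      \<le> D * Znorm (\<Sum>m | a m \<noteq> 0. a m *\<^sub>R interlace (\<lambda>n i. coord_embed n (y n i)) m)"
  proof (rule Z_dominated(2)[OF mem _ _ D], unfold coord)
    fix n
    show "(\<Sum>i | a (pos n i) \<noteq> 0. a (pos n i) *\<^sub>R x n i) \<in> Y n"
      by (intro comp.sum_mem comp.scaleR_mem x)
    show "nrm n (\<Sum>i | a (pos n i) \<noteq> 0. a (pos n i) *\<^sub>R x n i)
        \<le> D * nrm n (\<Sum>i | a (pos n i) \<noteq> 0. a (pos n i) *\<^sub>R y n i)"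
      using dom[of n] finite_component_support[OF a, of n] by (simp add: dominated_def)
  qed
qed

text \<open>A combination of the interlaced functionals is a finite sum \<open>\<Sum> f\<^sub>n \<circ> P\<^sub>n\<close>, where \<open>f\<^sub>n\<close> collects the terms
  from the \<open>n\<close>-th summand.\<close>

lemma dominated_functional_embed:
  assumes f: "\<And>n i. f n i \<in> dual (Y n) (nrm n)" and g: "\<And>n i. g n i \<in> dual (Y n) (nrm n)"
    and D: "0 \<le> D" and dom: "\<And>n. dominated D (dual_norm (Y n) (nrm n)) (f n) (g n)"
  shows "dominated D (dual_norm Z Znorm) (interlace (\<lambda>n i. functional_embed n (f n i)))
    (interlace (\<lambda>n i. functional_embed n (g n i)))"
  unfolding dominated_def
proof (intro allI impI)
  fix a :: "nat \<Rightarrow> real" assume a: "finite {m. a m \<noteq> 0}"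
  let ?A = "fst ` idx ` {m. a m \<noteq> 0}"
  let ?part = "\<lambda>h n. \<Sum>i | a (pos n i) \<noteq> 0. a (pos n i) *\<^sub>R h n i"
  have split: "(\<Sum>m | a m \<noteq> 0. a m *\<^sub>R interlace (\<lambda>n i. functional_embed n (h n i)) m)
      = (\<Sum>n\<in>?A. functional_embed n (?part h n))" (is "?lhs = _") for h
  proof -
    let ?t = "\<lambda>m. a m *\<^sub>R interlace (\<lambda>n i. functional_embed n (h n i)) m"
    have "?lhs = (\<Sum>n\<in>?A. \<Sum>m | m \<in> {m. a m \<noteq> 0} \<and> fst (idx m) = n. ?t m)"
      using a by (intro sum.group[symmetric]) auto
    also have "\<dots> = (\<Sum>n\<in>?A. functional_embed n (?part h n))"
    proof (rule sum.cong[OF refl])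
      fix n
      have "(\<Sum>m | m \<in> {m. a m \<noteq> 0} \<and> fst (idx m) = n. ?t m)
          = (\<Sum>i | a (pos n i) \<noteq> 0. ?t (pos n i))"
        by (rule sum.reindex_bij_witness[of _ "pos n" "\<lambda>m. snd (idx m)"])
            (auto simp: interlace_def pos_idx split: prod.split)
      also have "\<dots> = functional_embed n (?part h n)"
        by (simp add: linear_sum[OF linear_functional_embed] linear_scale[OF linear_functional_embed])
      finally show "(\<Sum>m | m \<in> {m. a m \<noteq> 0} \<and> fst (idx m) = n. ?t m) = functional_embed n (?part h n)" .
    qed
    finally show ?thesis .
  qed
  show "dual_norm Z Znorm (\<Sum>m | a m \<noteq> 0. a m *\<^sub>R interlace (\<lambda>n i. functional_embed n (f n i)) m)
      \<le> D * dual_norm Z Znorm (\<Sum>m | a m \<noteq> 0. a m *\<^sub>R interlace (\<lambda>n i. functional_embed n (g n i)) m)"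
    unfolding split
  proof (rule dual_norm_sum_mono[OF _ _ _ _ D])
    fix n
    show "?part f n \<in> dual (Y n) (nrm n)" "?part g n \<in> dual (Y n) (nrm n)"
      by (intro subspace_sum subspace_scale comp.dual_subspace f g)+
    show "dual_norm (Y n) (nrm n) (?part f n) \<le> D * dual_norm (Y n) (nrm n) (?part g n)"
      using dom[of n] finite_component_support[OF a, of n] by (simp add: dominated_def)
  qed (use a in simp)
qed

end

section \<open>Playing the component games side by side\<close>

context direct_sum_basis
begin

text \<open>The tolerance is the same in the component game because \<open>y \<mapsto> coord_embed n y\<close> and \<open>f \<mapsto> f \<circ> P\<^sub>n\<close> do not
  increase norms: a distance to a pulled back subspace bounds the distance to the subspace itself.\<close>

definition component_step1 :: "nat \<Rightarrow> (nat \<Rightarrow> 'b) step1 \<Rightarrow> 'b step1"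
  where "component_step1 n p = \<lparr>tol = tol p,
    prim_sub = {y \<in> Y n. coord_embed n y \<in> prim_sub p},
    dual_sub = {f \<in> dual (Y n) (nrm n). functional_embed n f \<in> dual_sub p}\<rparr>"

definition component_step2 :: "nat \<Rightarrow> step2 \<Rightarrow> step2"
  where "component_step2 n q = \<lparr>side = side q, supp = {i. pos n i \<in> supp q},
    lam = (\<lambda>i. lam q (pos n i)), mu = (\<lambda>i. mu q (pos n i))\<rparr>"

definition component_step3 :: "nat \<Rightarrow> step3 \<Rightarrow> step3"
  where "component_step3 n \<epsilon> = (\<lambda>i. \<epsilon> (pos n i))"

definition component_turn :: "nat \<Rightarrow> (nat \<Rightarrow> 'b) turn \<Rightarrow> 'b turn"
  where "component_turn n = (\<lambda>(p, q, \<epsilon>). (component_step1 n p, component_step2 n q, component_step3 n \<epsilon>))"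

definition component_partition :: "nat \<Rightarrow> nat set \<times> nat set \<Rightarrow> nat set \<times> nat set"
  where "component_partition n P = (pos n -` fst P, pos n -` snd P)"

definition lift_step2 :: "nat \<Rightarrow> step2 \<Rightarrow> step2"
  where "lift_step2 n q = \<lparr>side = side q, supp = pos n ` supp q,
    lam = (\<lambda>m. lam q (snd (idx m))), mu = (\<lambda>m. mu q (snd (idx m)))\<rparr>"

text \<open>Turn \<open>m\<close> is answered by the strategy for the summand of the \<open>m\<close>-th basis vector. The history shown to
  that strategy consists of the earlier turns that belong to the same summand; they are at the
  places \<open>pos n j\<close> with \<open>j < i\<close>, which precede \<open>m\<close> by the assumption on the order of the enumeration.\<close>

definition interlaced_strategy :: "(nat \<Rightarrow> 'b strategy) \<Rightarrow> (nat \<Rightarrow> 'b) strategy"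
  where "interlaced_strategy \<tau> P h p = (case idx (length h) of (n, i) \<Rightarrow>
    lift_step2 n (\<tau> n (component_partition n P)
      (map (\<lambda>j. component_turn n (h ! pos n j)) [0..<i]) (component_step1 n p)))"

text \<open>An equality of records, not just up to values off the support: a strategy may inspect the whole
  record of its own earlier moves, so the component history must reproduce it exactly.\<close>

lemma component_lift_step2 [simp]: "component_step2 n (lift_step2 n q) = q"
  using inj_pos[of n] by (cases q) (auto simp: component_step2_def lift_step2_def inj_def)

lemma legal_component_step1:
  "legal_step1 Z Znorm p \<Longrightarrow> legal_step1 (Y n) (nrm n) (component_step1 n p)"
  by (simp add: legal_step1_def component_step1_def cof_pullback cof_wstar_pullback)

lemma legal_lift_step2:
  assumes "legal_step2 \<eta> (component_partition n P) q"
  shows "legal_step2 \<eta> P (lift_step2 n q)"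
proof -
  have "(\<Sum>m\<in>pos n ` supp q. lam q (snd (idx m)) * mu q (snd (idx m))) = (\<Sum>i\<in>supp q. lam q i * mu q i)"
    using inj_pos by (subst sum.reindex) (auto intro: inj_on_subset)
  then show ?thesis
    using assms
    by (auto simp: legal_step2_def lift_step2_def component_partition_def split: if_splits)
qed

lemma legal_component_step3:
  "legal_step3 (lift_step2 n q) \<epsilon> \<Longrightarrow> legal_step3 q (component_step3 n \<epsilon>)"
  using inj_pos[of n]
  by (auto simp: legal_step3_def lift_step2_def component_step3_def PiE_def Pi_def extensional_def inj_image_mem_iff)

lemma block_vec_lift:
  "block_vec et (lift_step2 n q) \<epsilon> = coord_embed n (block_vec (b n) q (component_step3 n \<epsilon>))"
proof -
  have "block_vec et (lift_step2 n q) \<epsilon> = (\<Sum>i\<in>supp q. (\<epsilon> (pos n i) * lam q i) *\<^sub>R coord_embed n (b n i))"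
    unfolding block_vec_def lift_step2_def using inj_pos
    by (simp, subst sum.reindex) (auto intro: inj_on_subset simp: et_pos)
  then show ?thesis
    by (simp add: block_vec_def component_step3_def linear_sum[OF linear_coord_embed]
        linear_scale[OF linear_coord_embed])
qed

lemma biorth_pos: "biorth Z Znorm et (pos n i) = functional_embed n (biorth (Y n) (nrm n) (b n) i)"
  by (simp add: fun_eq_iff biorth_et functional_embed_def coeff_pos)

lemma block_fun_lift:
  "block_fun Z Znorm et (lift_step2 n q) \<epsilon>
    = functional_embed n (block_fun (Y n) (nrm n) (b n) q (component_step3 n \<epsilon>))"
proof -
  have "block_fun Z Znorm et (lift_step2 n q) \<epsilon>
      = (\<Sum>i\<in>supp q. (\<epsilon> (pos n i) * mu q i) *\<^sub>R functional_embed n (biorth (Y n) (nrm n) (b n) i))"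
    unfolding block_fun_def lift_step2_def using inj_pos
    by (simp, subst sum.reindex) (auto intro: inj_on_subset simp: biorth_pos)
  then show ?thesis
    by (simp add: block_fun_def component_step3_def linear_sum[OF linear_functional_embed]
        linear_scale[OF linear_functional_embed])
qed

lemma block_vec_mem: "block_vec (b n) q \<epsilon> \<in> Y n"
  unfolding block_vec_def by (intro comp.sum_mem comp.scaleR_mem comp.basis_mem)

lemma block_fun_mem_dual: "block_fun (Y n) (nrm n) (b n) q \<epsilon> \<in> dual (Y n) (nrm n)"
  unfolding block_fun_def by (intro subspace_sum subspace_scale comp.dual_subspace comp.biorth_mem_dual)

lemma dist_coord_embed_less:
  assumes x: "x \<in> Y n" and W: "W \<in> cof Z Znorm"
    and less: "dist_set (nrm n) x {y \<in> Y n. coord_embed n y \<in> W} < t"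
  shows "dist_set Znorm (coord_embed n x) W < t"
proof -
  have "{y \<in> Y n. coord_embed n y \<in> W} \<noteq> {}"
    using cof_pullback[OF W, of n] by (auto simp: cof_def finite_codim_def dest: subspace_0)
  then obtain y where y: "y \<in> Y n" "coord_embed n y \<in> W" "nrm n (x - y) < t"
    using dist_set_lessE[OF _ less] by blast
  have "W \<subseteq> Z" using W by (simp add: cof_def finite_codim_def)
  then have "dist_set Znorm (coord_embed n x) W \<le> Znorm (coord_embed n x - coord_embed n y)"
    using y x by (intro total.dist_set_le coord_embed_isometry(1))
  also have "\<dots> = nrm n (x - y)"
    using coord_embed_isometry(2)[OF comp.diff_mem[OF x y(1)]]
    by (simp only: linear_diff[OF linear_coord_embed])
  finally show ?thesis using y(3) by simp
qed

lemma dist_functional_embed_less: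
  assumes f: "f \<in> dual (Y n) (nrm n)" and G: "G \<in> cof_wstar Z Znorm"
    and less: "dist_set (dual_norm (Y n) (nrm n)) f {g \<in> dual (Y n) (nrm n). functional_embed n g \<in> G} < t"
  shows "dist_set (dual_norm Z Znorm) (functional_embed n f) G < t"
proof -
  interpret dual: normed_subspace "dual Z Znorm" "dual_norm Z Znorm"
    by (rule normed_subspace_dual) unfold_locales
  have "{g \<in> dual (Y n) (nrm n). functional_embed n g \<in> G} \<noteq> {}"
    using cof_wstar_pullback[OF G, of n] by (auto simp: cof_wstar_def finite_codim_def dest: subspace_0)
  then obtain g where g: "g \<in> dual (Y n) (nrm n)" "functional_embed n g \<in> G"
      "dual_norm (Y n) (nrm n) (f - g) < t"
    using dist_set_lessE[OF _ less] by blast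
  have "G \<subseteq> dual Z Znorm" using G by (simp add: cof_wstar_def finite_codim_def)
  then have "dist_set (dual_norm Z Znorm) (functional_embed n f) G
      \<le> dual_norm Z Znorm (functional_embed n f - functional_embed n g)"
    using g f by (intro dual.dist_set_le functional_embed_mem_dual)
  also have "\<dots> \<le> dual_norm (Y n) (nrm n) (f - g)"
    using dual_norm_functional_embed_le[OF subspace_diff[OF comp.dual_subspace f g(1)]]
    by (simp only: linear_diff[OF linear_functional_embed])
  finally show ?thesis using g(3) by simp
qed

text \<open>Each run of the game on the direct sum splits into runs of the component games in which the moves
  of player (II) are those of the component strategies. All of these runs are won, and the results of
  the preceding sections reassemble the four winning conditions.\<close>

theorem interlaced_strategy_wins:
  assumes C: "1 \<le> C" and \<eta>: "0 < \<eta>"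
    and \<tau>: "\<And>n. rep_winning_strategy (Y n) (nrm n) (b n) C \<eta> (\<tau> n)"
  shows "rep_winning_strategy Z Znorm et C \<eta> (interlaced_strategy \<tau>)"
  unfolding rep_winning_strategy_def
proof (intro allI impI)
  fix N1 N2 :: "nat set" and p q \<epsilon>
  assume N: "N1 \<union> N2 = UNIV" "N1 \<inter> N2 = {}" and p: "\<forall>k. legal_step1 Z Znorm (p k)"
    and q: "\<forall>k. q k = interlaced_strategy \<tau> (N1, N2) (map (\<lambda>j. (p j, q j, \<epsilon> j)) [0..<k]) (p k)"
    and \<epsilon>: "\<forall>k. legal_step3 (q k) (\<epsilon> k)"
  \<comment> \<open>the run of the component game on the \<open>n\<close>-th summand\<close>
  define p' where "p' n i = component_step1 n (p (pos n i))" for n i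
  define q' where "q' n i = component_step2 n (q (pos n i))" for n i
  define \<epsilon>' where "\<epsilon>' n i = component_step3 n (\<epsilon> (pos n i))" for n i
  let ?P = "\<lambda>n. component_partition n (N1, N2)"
  have q_lift_strategy: "q (pos n i) =
      lift_step2 n (\<tau> n (?P n) (map (\<lambda>j. (p' n j, q' n j, \<epsilon>' n j)) [0..<i]) (p' n i))" for n i
  proof -
    have history: "map (\<lambda>j. component_turn n (map (\<lambda>j. (p j, q j, \<epsilon> j)) [0..<pos n i] ! pos n j)) [0..<i]
        = map (\<lambda>j. (p' n j, q' n j, \<epsilon>' n j)) [0..<i]"
      using strict_mono_less[OF strict_mono_pos]
      by (auto simp: component_turn_def p'_def q'_def \<epsilon>'_def)
    show ?thesis
      using q[rule_format, of "pos n i"]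
      by (simp only: interlaced_strategy_def length_map length_upt diff_zero idx_pos prod.case
          history p'_def)
  qed
  then have q'_strategy: "q' n i = \<tau> n (?P n) (map (\<lambda>j. (p' n j, q' n j, \<epsilon>' n j)) [0..<i]) (p' n i)" for n i
    unfolding q'_def[of n i] by simp
  have q_lift: "q (pos n i) = lift_step2 n (q' n i)" for n i
    using arg_cong[OF q'_strategy[of n i], of "lift_step2 n"] q_lift_strategy[of n i]
    by (rule trans[OF _ sym, symmetric])
  have wins: "(\<forall>i. legal_step2 \<eta> (?P n) (q' n i)) \<and> rep_win (Y n) (nrm n) (b n) C \<eta> (p' n) (q' n) (\<epsilon>' n)" for n
  proof -
    have P: "?P n = (pos n -` N1, pos n -` N2)" by (simp add: component_partition_def)
    show ?thesis
      unfolding P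
    proof (rule \<tau>[unfolded rep_winning_strategy_def, rule_format, of "pos n -` N1" "pos n -` N2"])
      show "pos n -` N1 \<union> pos n -` N2 = UNIV" "pos n -` N1 \<inter> pos n -` N2 = {}"
        using N by auto
      show "legal_step1 (Y n) (nrm n) (p' n i)" for i
        using p by (simp add: p'_def legal_component_step1)
      show "legal_step3 (q' n i) (\<epsilon>' n i)" for i
        using \<epsilon>[rule_format, of "pos n i"] by (simp only: q_lift \<epsilon>'_def legal_component_step3)
      show "q' n i = \<tau> n (pos n -` N1, pos n -` N2) (map (\<lambda>j. (p' n j, q' n j, \<epsilon>' n j)) [0..<i]) (p' n i)" for i
        using q'_strategy[of n i] by (simp only: P)
    qed
  qed
  let ?x = "\<lambda>n i. block_vec (b n) (q' n i) (\<epsilon>' n i)"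
  let ?f = "\<lambda>n i. block_fun (Y n) (nrm n) (b n) (q' n i) (\<epsilon>' n i)"
  have vec: "block_vec et (q (pos n i)) (\<epsilon> (pos n i)) = coord_embed n (?x n i)"
    and func: "block_fun Z Znorm et (q (pos n i)) (\<epsilon> (pos n i)) = functional_embed n (?f n i)" for n i
    by (simp_all add: q_lift block_vec_lift block_fun_lift \<epsilon>'_def)
  have inter: "(\<lambda>k. block_vec et (q k) (\<epsilon> k)) = interlace (\<lambda>n i. coord_embed n (?x n i))"
    "et = interlace (\<lambda>n i. coord_embed n (b n i))"
    "(\<lambda>k. block_fun Z Znorm et (q k) (\<epsilon> k)) = interlace (\<lambda>n i. functional_embed n (?f n i))"
    "biorth Z Znorm et = interlace (\<lambda>n i. functional_embed n (biorth (Y n) (nrm n) (b n) i))"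
    by (rule interlace_eqI, simp add: vec func et_pos biorth_pos)+
  have C\<eta>: "0 < C + \<eta>" using C \<eta> by simp
  then have D: "0 \<le> sqrt (C + \<eta>)" by simp
  have "legal_step2 \<eta> (N1, N2) (q k)" for k
    by (cases k rule: pos_exhaust) (simp add: q_lift legal_lift_step2 wins)
  moreover have "impartially_equivalent (C + \<eta>) Znorm (\<lambda>k. block_vec et (q k) (\<epsilon> k)) Znorm et"
    unfolding inter(1) impartially_equivalent_iff_dominated[OF C\<eta>]
    using wins
    by (subst (1 2) inter(2), intro conjI dominated_coord_embed block_vec_mem comp.basis_mem D)
      (auto simp: rep_win_def impartially_equivalent_iff_dominated[OF C\<eta>])
  moreover have "impartially_equivalent (C + \<eta>)
      (dual_norm Z Znorm) (\<lambda>k. block_fun Z Znorm et (q k) (\<epsilon> k)) (dual_norm Z Znorm) (biorth Z Znorm et)"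
    unfolding inter(3,4) impartially_equivalent_iff_dominated[OF C\<eta>]
    using wins
    by (intro conjI dominated_functional_embed block_fun_mem_dual comp.biorth_mem_dual D)
      (auto simp: rep_win_def impartially_equivalent_iff_dominated[OF C\<eta>])
  moreover have "dist_set Znorm (block_vec et (q k) (\<epsilon> k)) (prim_sub (p k)) < tol (p k)" for k
  proof (cases k rule: pos_exhaust)
    fix n i assume k: "k = pos n i"
    have "dist_set (nrm n) (?x n i) (prim_sub (p' n i)) < tol (p' n i)"
      using wins by (simp add: rep_win_def)
    then show ?thesis
      using p unfolding k vec
      by (intro dist_coord_embed_less block_vec_mem) (auto simp: legal_step1_def p'_def component_step1_def)
  qed
  moreover have "dist_set (dual_norm Z Znorm) (block_fun Z Znorm et (q k) (\<epsilon> k)) (dual_sub (p k)) < tol (p k)" for k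
  proof (cases k rule: pos_exhaust)
    fix n i assume k: "k = pos n i"
    have "dist_set (dual_norm (Y n) (nrm n)) (?f n i) (dual_sub (p' n i)) < tol (p' n i)"
      using wins by (simp add: rep_win_def)
    then show ?thesis
      using p unfolding k func
      by (intro dist_functional_embed_less block_fun_mem_dual) (auto simp: legal_step1_def p'_def component_step1_def)
  qed
  ultimately show "(\<forall>k. legal_step2 \<eta> (N1, N2) (q k)) \<and> rep_win Z Znorm et C \<eta> p q \<epsilon>"
    by (simp add: rep_win_def)
qed

end

theorem proposition7p5:
  fixes e :: "nat \<Rightarrow> 'x::banach"
    and Y :: "nat \<Rightarrow> 'b::real_vector set"
    and nrm :: "nat \<Rightarrow> 'b \<Rightarrow> real"
    and b :: "nat \<Rightarrow> nat \<Rightarrow> 'b"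
    and lambda C :: real
    and idx :: "nat \<Rightarrow> nat \<times> nat"
    and et :: "nat \<Rightarrow> nat \<Rightarrow> 'b"
  assumes "schauder_basis UNIV norm e" and "normalized norm e" and "unconditional 1 norm e"
    and "\<And>n. banach_on (Y n) (nrm n)"
    and "lambda \<ge> 1" and "C \<ge> 1"
    and "\<And>n. schauder_basis (Y n) (nrm n) (b n)"
    and "\<And>n. normalized (nrm n) (b n)"
    and "\<And>n. strategically_reproducible C (Y n) (nrm n) (b n)"
    and "\<And>n. basis_constant (Y n) (nrm n) (b n) \<le> ereal lambda"
    and "bij idx"
    and "\<And>m n i. idx m = (n, i) \<Longrightarrow> et m = coord_embed n (b n i)"
    and "\<And>n i j. i < j \<Longrightarrow> inv idx (n, i) < inv idx (n, j)"
  shows "schauder_basis (sum_space e Y nrm) (sum_norm e nrm) et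
    \<and> strategically_reproducible C (sum_space e Y nrm) (sum_norm e nrm) et
    \<and> basis_constant (sum_space e Y nrm) (sum_norm e nrm) et \<le> ereal lambda"
proof -
  interpret direct_sum_basis e Y nrm b lambda idx et
    by unfold_locales (fact assms)+
  have "\<exists>\<sigma>. rep_winning_strategy Z Znorm et C \<eta> \<sigma>" if \<eta>: "0 < \<eta>" for \<eta>
  proof -
    have "\<exists>\<tau>. \<forall>n. rep_winning_strategy (Y n) (nrm n) (b n) C \<eta> (\<tau> n)"
      using assms(9) \<eta> by (intro choice) (simp add: strategically_reproducible_def)
    then show ?thesis
      using interlaced_strategy_wins[OF \<open>C \<ge> 1\<close> \<eta>] by blast
  qed
  then show ?thesis
    using banach_Z schauder_basis_et total.normalized basis_constant_et
    by (simp add: strategically_reproducible_def)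
qed

end
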